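(* Let $A$ be a commutative and semisimple Banach algebra such that the weak topology and the weak-* topology coincide on $\Delta(A)$. Then $C_{BSE}(\Delta(A))$ is a dual Banach algebra with predual $B=\overline{\langle\Delta(A)\rangle}^{\|\cdot\|_{A^*}}$, where $C_{BSE}(\Delta(A))$ is identified with $B^*$ by letting $\sigma\in C_{BSE}(\Delta(A))$ act on $B$ as the continuous linear extension of $\sum_{k=1}^n\lambda_k\varphi_k\mapsto\sum_{k=1}^n\lambda_k\sigma(\varphi_k)$ ($\varphi_k\in\Delta(A)$, $\lambda_k\in\mathbb C$).
   Context: Banach algebras are over $\mathbb C$; $A^*$ and $A^{**}$ are the dual and second dual of $A$. $\Delta(A)\subseteq A^*$ is the set of all nonzero multiplicative linear functionals on $A$, with the Gelfand (relative weak-* ) topology $\sigma(A^*,A)$ unless otherwise stated; the weak topology on $\Delta(A)$ is the relative topology $\sigma(A^*,A^{**})$. $\langle\Delta(A)\rangle$ is the linear span of $\Delta(A)$ in $A^*$. A bounded continuous function $\sigma:\Delta(A)\to\mathbb C$ is a BSE-function if there is $M>0$ such that $\left|\sum_{j=1}^n c_j\sigma(\varphi_j)\right|\le M\left\|\sum_{j=1}^n c_j\varphi_j\right\|_{A^*}$ for all finite choices $\varphi_1,\dots,\varphi_n\in\Delta(A)$ and $c_1,\dots,c_n\in\mathbb C$. The infimum of all such $M$ is $\|\sigma\|_{BSE}$. $C_{BSE}(\Delta(A))$ is the set of all BSE-functions; with pointwise operations and the norm $\|\cdot\|_{BSE}$ it is a commutative semisimple Banach algebra. A dual Banach algebra is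 a pair $(D,D_* )$ where $D$ is a Banach algebra, $D=(D_* )^*$ as a Banach space, and multiplication in $D$ is separately $\sigma(D,D_* )$-continuous; equivalently, $D\cdot D_*\subseteq D_*$ and $D_*\cdot D\subseteq D_*$, where $D_*\subseteq D^*$ canonically and $D^*$ carries its natural $D$-bimodule structure. *)

theory Defs
  imports "HOL-Analysis.Analysis" "HOL-Library.Function_Algebras"
begin

section \<open>Complex vector spaces and normed algebras\<close>

class complex_vector = ab_group_add +
  fixes scaleC :: "complex \<Rightarrow> 'a \<Rightarrow> 'a" (infixr "*\<^sub>C" 75)
  assumes scaleC_add_right: "a *\<^sub>C (x + y) = a *\<^sub>C x + a *\<^sub>C y"
    and scaleC_add_left: "(a + b) *\<^sub>C x = a *\<^sub>C x + b *\<^sub>C x"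
    and scaleC_scaleC: "a *\<^sub>C b *\<^sub>C x = (a * b) *\<^sub>C x"
    and scaleC_one: "1 *\<^sub>C x = x"

global_interpretation complex_vector:
  vector_space "scaleC :: complex \<Rightarrow> 'a \<Rightarrow> 'a::complex_vector"
  defines csubspace = complex_vector.subspace
    and cspan = complex_vector.span
  by unfold_locales
    (simp_all add: scaleC_add_right scaleC_add_left scaleC_scaleC scaleC_one)

class complex_normed_vector = complex_vector + real_normed_vector +
  assumes scaleR_scaleC: "r *\<^sub>R x = complex_of_real r *\<^sub>C x"
    and norm_scaleC: "norm (c *\<^sub>C x) = cmod c * norm x"

class complex_algebra = complex_vector + ring +
  assumes mult_scaleC_left: "(c *\<^sub>C x) * y = c *\<^sub>C (x * y)"
    and mult_scaleC_right: "x * (c *\<^sub>C y) = c *\<^sub>C (x * y)"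

text \<open>No unit is required. A complex Banach algebra is a type of sort
  \<open>{complex_normed_algebra, banach}\<close>.\<close>

class complex_normed_algebra = complex_normed_vector + complex_algebra + real_normed_algebra

instantiation complex :: "{complex_normed_algebra, complex_algebra}"
begin

definition scaleC_complex :: "complex \<Rightarrow> complex \<Rightarrow> complex"
  where [simp]: "scaleC_complex = (*)"

instance
  by standard (simp_all add: algebra_simps scaleR_conv_of_real norm_mult)

end

instantiation "fun" :: (type, complex_vector) complex_vector
begin

definition scaleC_fun :: "complex \<Rightarrow> ('a \<Rightarrow> 'b) \<Rightarrow> 'a \<Rightarrow> 'b"
  where "scaleC_fun c f = (\<lambda>x. c *\<^sub>C f x)"

instance
  by standard
    (simp_all add: scaleC_fun_def plus_fun_def scaleC_add_right scaleC_add_left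
      scaleC_scaleC scaleC_one)

end

instance "fun" :: (type, complex_algebra) complex_algebra
  by standard
    (simp_all add: scaleC_fun_def times_fun_def mult_scaleC_left mult_scaleC_right)

lemma bounded_linear_scaleC:
  "bounded_linear (\<lambda>x::'a::complex_normed_vector. c *\<^sub>C x)"
  by (rule bounded_linear_intro[where K = "cmod c"])
    (simp_all add: scaleC_add_right scaleR_scaleC scaleC_scaleC norm_scaleC mult.commute)

instantiation blinfun :: (real_normed_vector, complex_normed_vector) complex_normed_vector
begin

lift_definition scaleC_blinfun :: "complex \<Rightarrow> 'a \<Rightarrow>\<^sub>L 'b \<Rightarrow> 'a \<Rightarrow>\<^sub>L 'b"
  is "\<lambda>c f x. c *\<^sub>C f x"
  by (rule bounded_linear_compose[OF bounded_linear_scaleC])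

instance
proof
  fix a b c :: complex and r :: real and f g :: "'a \<Rightarrow>\<^sub>L 'b"
  show "a *\<^sub>C (f + g) = a *\<^sub>C f + a *\<^sub>C g"
    by transfer (simp add: scaleC_add_right)
  show "(a + b) *\<^sub>C f = a *\<^sub>C f + b *\<^sub>C f"
    by transfer (simp add: scaleC_add_left)
  have sc: "a *\<^sub>C b *\<^sub>C f = (a * b) *\<^sub>C f" for a b and f :: "'a \<Rightarrow>\<^sub>L 'b"
    by transfer (simp add: scaleC_scaleC)
  then show "a *\<^sub>C b *\<^sub>C f = (a * b) *\<^sub>C f" .
  have one: "1 *\<^sub>C f = f" for f :: "'a \<Rightarrow>\<^sub>L 'b"
    by transfer (simp add: scaleC_one)
  then show "1 *\<^sub>C f = f" .
  show "r *\<^sub>R f = complex_of_real r *\<^sub>C f"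
    by transfer (simp add: scaleR_scaleC)
  have le: "norm (c *\<^sub>C f) \<le> cmod c * norm f" for c and f :: "'a \<Rightarrow>\<^sub>L 'b"
  proof (rule norm_blinfun_bound)
    fix x
    have "norm (blinfun_apply (c *\<^sub>C f) x) = cmod c * norm (blinfun_apply f x)"
      by (simp add: scaleC_blinfun.rep_eq norm_scaleC)
    also have "\<dots> \<le> cmod c * (norm f * norm x)"
      by (intro mult_left_mono norm_blinfun) simp
    finally show "norm (blinfun_apply (c *\<^sub>C f) x) \<le> cmod c * norm f * norm x"
      by (simp add: mult.assoc)
  qed simp
  show "norm (c *\<^sub>C f) = cmod c * norm f"
  proof (cases "c = 0")
    case True
    then show ?thesis
      using le[of c f] by simp
  next
    case False
    have "norm f = norm (inverse c *\<^sub>C c *\<^sub>C f)"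
      using False by (simp add: sc one)
    also have "\<dots> \<le> cmod (inverse c) * norm (c *\<^sub>C f)"
      by (rule le)
    finally have "cmod c * norm f \<le> norm (c *\<^sub>C f)"
      using False by (simp add: norm_inverse norm_divide field_simps)
    with le[of c f] show ?thesis
      by simp
  qed
qed

end


section \<open>Dual spaces and weak topologies\<close>

text \<open>The norm of \<open>'a \<Rightarrow>\<^sub>L complex\<close> is the operator norm, so this is the dual
  \<open>A\<^sup>*\<close> with its dual norm.\<close>

definition dual_space :: "('a::complex_normed_vector \<Rightarrow>\<^sub>L complex) set"
  where "dual_space = {f. \<forall>c x. blinfun_apply f (c *\<^sub>C x) = c * blinfun_apply f x}"

text \<open>The dual of a subspace \<open>P\<close>; functionals on \<open>P\<close> are represented by functions
  vanishing outside \<open>P\<close>.\<close>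

definition dual_on :: "'v::complex_normed_vector set \<Rightarrow> ('v \<Rightarrow> complex) set"
  where "dual_on P = {F. (\<forall>x. x \<notin> P \<longrightarrow> F x = 0) \<and>
    (\<forall>x\<in>P. \<forall>y\<in>P. F (x + y) = F x + F y) \<and>
    (\<forall>c. \<forall>x\<in>P. F (c *\<^sub>C x) = c * F x) \<and>
    (\<exists>K. \<forall>x\<in>P. cmod (F x) \<le> K * norm x)}"

definition dual_norm_on :: "'v::complex_normed_vector set \<Rightarrow> ('v \<Rightarrow> complex) \<Rightarrow> real"
  where "dual_norm_on P F = (SUP x\<in>{x \<in> P. norm x \<le> 1}. cmod (F x))"

text \<open>The initial topology \<open>\<sigma>(X, Fs)\<close> on \<open>X\<close> induced by a (nonempty) family of functions.\<close>

definition initial_topology_on :: "'x set \<Rightarrow> ('x \<Rightarrow> complex) set \<Rightarrow> 'x topology"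
  where "initial_topology_on X Fs =
    topology_generated_by {{x \<in> X. f x \<in> U} | f U. f \<in> Fs \<and> open U}"

definition weak_star_topology :: "('a::complex_normed_vector \<Rightarrow>\<^sub>L complex) topology"
  where "weak_star_topology =
    initial_topology_on dual_space (range (\<lambda>a f. blinfun_apply f a))"

definition weak_topology :: "('a::complex_normed_vector \<Rightarrow>\<^sub>L complex) topology"
  where "weak_topology = initial_topology_on dual_space (dual_on dual_space)"


section \<open>Characters and semisimplicity\<close>

definition character_space :: "('a::complex_normed_algebra \<Rightarrow>\<^sub>L complex) set"
  where "character_space = {\<phi> \<in> dual_space. \<phi> \<noteq> 0 \<and>
    (\<forall>x y. blinfun_apply \<phi> (x * y) = blinfun_apply \<phi> x * blinfun_apply \<phi> y)}"

text \<open>In a possibly non-unital algebra the Jacobson radical is the intersection of the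
  maximal \<^emph>\<open>modular\<close> ideals. Multiplication is assumed commutative, so one-sided
  conditions suffice.\<close>

definition modular_ideal :: "'a::{complex_algebra, comm_ring} set \<Rightarrow> bool"
  where "modular_ideal I \<longleftrightarrow> csubspace I \<and> (\<forall>a. \<forall>x\<in>I. a * x \<in> I) \<and>
    (\<exists>u. \<forall>x. x - u * x \<in> I)"

definition maximal_modular_ideal :: "'a::{complex_algebra, comm_ring} set \<Rightarrow> bool"
  where "maximal_modular_ideal I \<longleftrightarrow> modular_ideal I \<and> I \<noteq> UNIV \<and>
    (\<forall>J. modular_ideal J \<and> I \<subseteq> J \<longrightarrow> J = I \<or> J = UNIV)"

definition semisimple :: "'a::{complex_algebra, comm_ring} itself \<Rightarrow> bool"
  where "semisimple _ \<longleftrightarrow> \<Inter>{I::'a set. maximal_modular_ideal I} = {0}"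


section \<open>BSE-functions\<close>

definition bse_bound :: "(('a::complex_normed_algebra \<Rightarrow>\<^sub>L complex) \<Rightarrow> complex) \<Rightarrow> real \<Rightarrow> bool"
  where "bse_bound \<sigma> M \<longleftrightarrow> M > 0 \<and>
    (\<forall>(n::nat) \<phi> c. (\<forall>j<n. \<phi> j \<in> character_space) \<longrightarrow>
      cmod (\<Sum>j<n. c j * \<sigma> (\<phi> j)) \<le> M * norm (\<Sum>j<n. c j *\<^sub>C \<phi> j))"

text \<open>Functions on \<open>\<Delta>(A)\<close> are represented by functions vanishing outside \<open>\<Delta>(A)\<close>, so that
  the pointwise operations are those of the ambient function type.\<close>

definition C_BSE :: "(('a::complex_normed_algebra \<Rightarrow>\<^sub>L complex) \<Rightarrow> complex) set"
  where "C_BSE = {\<sigma>. (\<forall>\<phi>. \<phi> \<notin> character_space \<longrightarrow> \<sigma> \<phi> = 0) \<and>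
    continuous_map (subtopology weak_star_topology character_space) euclidean \<sigma> \<and>
    bounded (\<sigma> ` character_space) \<and> (\<exists>M. bse_bound \<sigma> M)}"

definition bse_norm :: "(('a::complex_normed_algebra \<Rightarrow>\<^sub>L complex) \<Rightarrow> complex) \<Rightarrow> real"
  where "bse_norm \<sigma> = Inf {M. bse_bound \<sigma> M}"

definition bse_predual :: "('a::complex_normed_algebra \<Rightarrow>\<^sub>L complex) set"
  where "bse_predual = closure (cspan character_space)"

definition is_bse_extension ::
    "(('a::complex_normed_algebra \<Rightarrow>\<^sub>L complex) \<Rightarrow> complex) \<Rightarrow>
      (('a \<Rightarrow>\<^sub>L complex) \<Rightarrow> complex) \<Rightarrow> bool"
  where "is_bse_extension \<sigma> F \<longleftrightarrow> F \<in> dual_on bse_predual \<and>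
    (\<forall>(n::nat) \<phi> c. (\<forall>k<n. \<phi> k \<in> character_space) \<longrightarrow>
      F (\<Sum>k<n. c k *\<^sub>C \<phi> k) = (\<Sum>k<n. c k * \<sigma> (\<phi> k)))"

definition bse_extension ::
    "(('a::complex_normed_algebra \<Rightarrow>\<^sub>L complex) \<Rightarrow> complex) \<Rightarrow>
      ('a \<Rightarrow>\<^sub>L complex) \<Rightarrow> complex"
  where "bse_extension \<sigma> = (THE F. is_bse_extension \<sigma> F)"


section \<open>Dual Banach algebras\<close>

text \<open>A subalgebra \<open>D\<close> of an ambient complex algebra that is a Banach algebra under the
  norm \<open>N\<close>, which need not come from a norm on the ambient type.\<close>

locale banach_algebra_on =
  fixes D :: "'d::complex_algebra set" and N :: "'d \<Rightarrow> real"
  assumes subspace: "csubspace D"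
    and mult_closed: "x \<in> D \<Longrightarrow> y \<in> D \<Longrightarrow> x * y \<in> D"
    and norm_nonneg: "x \<in> D \<Longrightarrow> 0 \<le> N x"
    and norm_eq_0: "x \<in> D \<Longrightarrow> N x = 0 \<longleftrightarrow> x = 0"
    and norm_triangle: "x \<in> D \<Longrightarrow> y \<in> D \<Longrightarrow> N (x + y) \<le> N x + N y"
    and norm_scale: "x \<in> D \<Longrightarrow> N (c *\<^sub>C x) = cmod c * N x"
    and norm_mult: "x \<in> D \<Longrightarrow> y \<in> D \<Longrightarrow> N (x * y) \<le> N x * N y"
    and complete: "(\<And>n::nat. X n \<in> D) \<Longrightarrow>
      (\<And>e. e > 0 \<Longrightarrow> \<exists>K. \<forall>m\<ge>K. \<forall>n\<ge>K. N (X m - X n) < e) \<Longrightarrow>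
      \<exists>x\<in>D. (\<lambda>n. N (X n - x)) \<longlonglongrightarrow> 0"

text \<open>The weak-* topology \<open>\<sigma>(D, P)\<close>, where \<open>D\<close> is identified with the dual of \<open>P\<close> by \<open>T\<close>.\<close>

definition predual_topology ::
    "'d set \<Rightarrow> 'p set \<Rightarrow> ('d \<Rightarrow> 'p \<Rightarrow> complex) \<Rightarrow> 'd topology"
  where "predual_topology D P T = initial_topology_on D ((\<lambda>p x. T x p) ` P)"

text \<open>The Banach algebra \<open>D\<close> is a dual Banach algebra with predual \<open>P\<close>, a Banach space, where
  \<open>T\<close> is the isometric isomorphism through which \<open>D\<close> is identified with the dual of \<open>P\<close>.\<close>

locale dual_banach_algebra = banach_algebra_on D N
  for D :: "'d::complex_algebra set" and N :: "'d \<Rightarrow> real" +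
  fixes P :: "'p::complex_normed_vector set" and T :: "'d \<Rightarrow> 'p \<Rightarrow> complex"
  assumes predual_subspace: "csubspace P"
    and predual_complete: "complete P"
    and bij: "bij_betw T D (dual_on P)"
    and add: "x \<in> D \<Longrightarrow> y \<in> D \<Longrightarrow> T (x + y) = T x + T y"
    and scale: "x \<in> D \<Longrightarrow> T (c *\<^sub>C x) = c *\<^sub>C T x"
    and isometric: "x \<in> D \<Longrightarrow> dual_norm_on P (T x) = N x"
    and mult_left_continuous: "a \<in> D \<Longrightarrow>
      continuous_map (predual_topology D P T) (predual_topology D P T) (\<lambda>x. a * x)"
    and mult_right_continuous: "a \<in> D \<Longrightarrow>
      continuous_map (predual_topology D P T) (predual_topology D P T) (\<lambda>x. x * a)"

end

theory Submission
  imports Defs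
begin

text \<open>A BSE-function is the same thing as a functional on the span of the characters that is
  bounded for the dual norm. Conversely, a bounded functional on the predual extends by
  Hahn--Banach to an element of the second dual, so its restriction to the characters is weakly
  continuous, hence continuous by the hypothesis on the two topologies. This gives the isometric
  identification of the BSE-functions with the dual of the predual. Since the characters are
  multiplicative, \<open>\<phi> \<mapsto> \<tau> \<phi> \<cdot> \<phi>\<close> extends, for every BSE-function \<open>\<tau>\<close>, to a bounded operator on
  the predual; multiplication by \<open>\<tau>\<close> is its adjoint, which yields both submultiplicativity of
  the norm and weak-* continuity.\<close>

section \<open>The Hahn--Banach theorem\<close>

text \<open>Two obstacles shape the argument. A formula on combinations of characters must be well
  defined before it can be extended. \<open>comb_bound\<close> settles this together with
  continuity: a bound by the norm of the combination forces every linear relation among characters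
  to hold among the values. It is stated for vector-valued maps, so that functionals on the predual
  and the multiplication operators on it come from one extension result. The second obstacle is that
  membership in \<open>C_BSE\<close> also asks for boundedness and continuity. Boundedness holds
  because characters lie in the unit ball. Continuity is where the two topologies enter, once, in
  \<open>mem_C_BSE_iff\<close>; from there on sums, products, restrictions of functionals and limits
  of Cauchy sequences are recognised as BSE-functions by their constants alone. The extension by
  Hahn-Banach only has to be bounded, because the isometry is measured on the predual
  itself.\<close>

definition sublinear :: "('v::real_vector \<Rightarrow> real) \<Rightarrow> bool"
  where "sublinear p \<longleftrightarrow> (\<forall>x y. p (x + y) \<le> p x + p y) \<and> (\<forall>r>0. \<forall>x. p (r *\<^sub>R x) \<le> r * p x)"

lemma sublinearI:
  assumes "\<And>x y. p (x + y) \<le> p x + p y" "\<And>r x. r > 0 \<Longrightarrow> p (r *\<^sub>R x) \<le> r * p x"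
  shows "sublinear p"
  using assms by (simp add: sublinear_def)

lemma sublinear_add: "sublinear p \<Longrightarrow> p (x + y) \<le> p x + p y"
  by (simp add: sublinear_def)

lemma sublinear_scale_le: "sublinear p \<Longrightarrow> r > 0 \<Longrightarrow> p (r *\<^sub>R x) \<le> r * p x"
  by (simp add: sublinear_def)

lemma sublinear_zero:
  assumes "sublinear p"
  shows "p 0 = 0"
  \<comment> \<open>The factor 2 gives \<open>p 0 \<ge> 0\<close>, the factor 1/2 gives
    \<open>p 0 \<le> 0\<close>.\<close>
  using sublinear_scale_le[OF assms, of 2 0] sublinear_scale_le[OF assms, of "1/2" 0] by simp

text \<open>Scaling back by \<open>inverse r\<close> reverses the inequality. Hence
  \<open>sublinear\<close> asks for one direction only, which is all that has to be checked for the
  infima below.\<close>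

lemma sublinear_scale:
  assumes "sublinear p" "r \<ge> 0"
  shows "p (r *\<^sub>R x) = r * p x"
proof (cases "r = 0")
  case False
  with assms(2) have r: "r > 0" by simp
  have "p (inverse r *\<^sub>R r *\<^sub>R x) \<le> inverse r * p (r *\<^sub>R x)"
    using r by (intro sublinear_scale_le[OF assms(1)]) simp
  then have "r * p x \<le> p (r *\<^sub>R x)"
    using r by (simp add: field_simps)
  with sublinear_scale_le[OF assms(1) r, of x] show ?thesis by simp
qed (simp add: sublinear_zero[OF assms(1)])

text \<open>The source of lower bounds: whenever \<open>p \<le> q\<close>, it yields
  \<open>- q (- x) \<le> p x\<close>, so pointwise infima of such \<open>p\<close> are
  finite.\<close>

lemma sublinear_minus: "sublinear p \<Longrightarrow> - p (- x) \<le> p x"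
  using sublinear_add[of p x "- x"] sublinear_zero[of p] by simp

lemma minimal_sublinear_exists:
  fixes q :: "'v::real_vector \<Rightarrow> real"
  assumes q: "sublinear q"
  obtains p where "sublinear p" "\<And>x. p x \<le> q x"
    "\<And>p'. sublinear p' \<Longrightarrow> (\<And>x. p' x \<le> p x) \<Longrightarrow> p' = p"
proof -
  let ?A = "{p. sublinear p \<and> (\<forall>x. p x \<le> q x)}"
  \<comment> \<open>The order is reversed: a maximal element for \<open>?P\<close> is a minimal
    functional, and a chain is bounded by its pointwise infimum.\<close>
  let ?P = "\<lambda>p p'. \<forall>x. p' x \<le> (p x :: real)"
  have "\<exists>m\<in>?A. \<forall>a\<in>?A. ?P m a \<longrightarrow> a = m"
  proof (rule predicate_Zorn)
    show "partial_order_on ?A (relation_of ?P ?A)"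
      by (rule partial_order_on_relation_ofI) (auto simp: fun_eq_iff intro: order_trans antisym)
    fix C assume C: "C \<in> Chains (relation_of ?P ?A)"
    then have sub: "p \<in> ?A" if "p \<in> C" for p
      using that by (auto simp: Chains_def relation_of_def)
    show "\<exists>u\<in>?A. \<forall>a\<in>C. ?P a u"
    proof (cases "C = {}")
      case True
      then show ?thesis using q by auto
    next
      case False
      define u where "u x = (INF p\<in>C. p x)" for x
      have "- q (- x) \<le> p x" if "p \<in> C" for p x
        using sub[OF that] sublinear_minus[of p x] by (smt (verit) mem_Collect_eq)
      then have bdd: "bdd_below ((\<lambda>p. p x) ` C)" for x
        by (intro bdd_belowI2[where m = "- q (- x)"])
      have le: "u x \<le> p x" if "p \<in> C" for p x
        unfolding u_def using that bdd by (auto intro: cINF_lower)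
      have "sublinear u"
      proof (rule sublinearI)
        fix x y
        have "u (x + y) - p x \<le> u y" if p: "p \<in> C" for p
          unfolding u_def[of y]
        proof (rule cINF_greatest[OF False])
          fix p' assume p': "p' \<in> C"
          \<comment> \<open>The two infima may be approached by different members of the chain; the
            smaller of \<open>p\<close> and \<open>p'\<close> serves both at once.\<close>
          obtain p'' where "p'' \<in> C" "p'' x \<le> p x" "p'' y \<le> p' y"
            using C p p' by (force simp: Chains_def relation_of_def)
          with le[of p'' "x + y"] sub[of p''] sublinear_add[of p'' x y]
          show "u (x + y) - p x \<le> p' y" by auto
        qed
        then have "u (x + y) - u y \<le> u x"
          unfolding u_def[of x] by (intro cINF_greatest[OF False]) (simp add: algebra_simps)
        then show "u (x + y) \<le> u x + u y" by simp
      next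
        fix r :: real and x assume r: "r > 0"
        have "u (r *\<^sub>R x) / r \<le> u x"
          unfolding u_def[of x]
        proof (rule cINF_greatest[OF False])
          fix p assume "p \<in> C"
          with le[of p "r *\<^sub>R x"] sub[of p] sublinear_scale_le[of p r x] r
          show "u (r *\<^sub>R x) / r \<le> p x" by (auto simp: field_simps)
        qed
        then show "u (r *\<^sub>R x) \<le> r * u x" using r by (simp add: field_simps)
      qed
      moreover have "u x \<le> q x" for x
      proof -
        obtain p where "p \<in> C" using False by blast
        with le[of p x] sub[of p] show ?thesis by (auto intro: order_trans)
      qed
      ultimately show ?thesis using le by auto
    qed
  qed
  then obtain m where "m \<in> ?A" and m: "\<And>a. a \<in> ?A \<Longrightarrow> ?P m a \<Longrightarrow> a = m"
    by blast
  then show ?thesis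
    by (intro that[of m]) (auto intro: order_trans)
qed

text \<open>Minimality is tested against \<open>x \<mapsto> inf\<^bsub>t\<ge>0\<^esub> p (x + t y) - t p y\<close>; taking \<open>t = 1\<close> gives
  \<open>p x \<le> p (x + y) - p y\<close>.\<close>

lemma minimal_sublinear_linear:
  fixes p :: "'v::real_vector \<Rightarrow> real"
  assumes p: "sublinear p"
    and min: "\<And>p'. sublinear p' \<Longrightarrow> (\<And>x. p' x \<le> p x) \<Longrightarrow> p' = p"
  shows "linear p"
proof -
  have add: "p (x + y) = p x + p y" for x y
  proof -
    define u where "u x = (INF t\<in>{0..}. p (x + t *\<^sub>R y) - t * p y)" for x
    have "- p (- x) \<le> p (x + t *\<^sub>R y) - t * p y" if "t \<ge> 0" for t x
      using sublinear_add[OF p, of "x + t *\<^sub>R y" "- x"] sublinear_scale[OF p that, of y] by simp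
    then have "bdd_below ((\<lambda>t. p (x + t *\<^sub>R y) - t * p y) ` {0..})" for x
      by (intro bdd_belowI2[where m = "- p (- x)"]) auto
    then have le: "u x \<le> p (x + t *\<^sub>R y) - t * p y" if "t \<ge> 0" for t x
      unfolding u_def using that by (auto intro: cINF_lower)
    have "sublinear u"
    proof (rule sublinearI)
      fix x z
      \<comment> \<open>Parameters add: \<open>t\<close> at \<open>x\<close> and \<open>s\<close> at
        \<open>z\<close> give the competitor \<open>t + s\<close> at \<open>x + z\<close>.\<close>
      have "u (x + z) - (p (x + t *\<^sub>R y) - t * p y) \<le> u z" if t: "t \<ge> 0" for t
        unfolding u_def[of z]
      proof (rule cINF_greatest)
        fix s :: real assume s: "s \<in> {0..}"
        then show "u (x + z) - (p (x + t *\<^sub>R y) - t * p y) \<le> p (z + s *\<^sub>R y) - s * p y"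
          using le[of "t + s" "x + z"] t sublinear_add[OF p, of "x + t *\<^sub>R y" "z + s *\<^sub>R y"]
          by (simp add: algebra_simps)
      qed simp
      then have "u (x + z) - u z \<le> u x"
        unfolding u_def[of x] by (intro cINF_greatest) (simp_all add: algebra_simps)
      then show "u (x + z) \<le> u x + u z" by simp
    next
      fix r :: real and x assume r: "r > 0"
      have "u (r *\<^sub>R x) / r \<le> u x"
        unfolding u_def[of x]
      proof (rule cINF_greatest)
        fix t :: real assume "t \<in> {0..}"
        then show "u (r *\<^sub>R x) / r \<le> p (x + t *\<^sub>R y) - t * p y"
          using r le[of "r * t" "r *\<^sub>R x"] sublinear_scale_le[OF p r, of "x + t *\<^sub>R y"]
          by (simp add: field_simps scaleR_add_right)
      qed simp
      then show "u (r *\<^sub>R x) \<le> r * u x" using r by (simp add: field_simps)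
    qed
    moreover have "u x \<le> p x" for x
      using le[of 0 x] by simp
    ultimately have "u = p" by (rule min)
    with le[of 1 x] sublinear_add[OF p, of x y] show ?thesis by simp
  qed
  have minus: "p (- x) = - p x" for x
    using add[of x "- x"] sublinear_zero[OF p] by simp
  show ?thesis
  proof (rule linearI)
    fix r x
    show "p (r *\<^sub>R x) = r *\<^sub>R p x"
    proof (cases "r \<ge> 0")
      case False
      then show ?thesis
        using sublinear_scale[OF p, of "- r" x] minus[of "r *\<^sub>R x"] by simp
    qed (simp add: sublinear_scale[OF p])
  qed (rule add)
qed

text \<open>The functional \<open>q\<close> is the largest sublinear one that lies below
  \<open>f\<close> on \<open>S\<close> and below \<open>K * norm\<close> everywhere. A minimal
  sublinear functional under it is linear, and a linear functional below \<open>f\<close> on a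
  subspace agrees with \<open>f\<close> there, as the comparison at \<open>- x\<close> shows. This
  replaces extension by one dimension at a time.\<close>

theorem hahn_banach_real:
  fixes f :: "'v::real_normed_vector \<Rightarrow> real"
  assumes S: "subspace S"
    and add: "\<And>x y. x \<in> S \<Longrightarrow> y \<in> S \<Longrightarrow> f (x + y) = f x + f y"
    and scale: "\<And>r x. x \<in> S \<Longrightarrow> f (r *\<^sub>R x) = r * f x"
    and bound: "\<And>x. x \<in> S \<Longrightarrow> \<bar>f x\<bar> \<le> K * norm x" and K: "K \<ge> 0"
  obtains g where "linear g" "\<And>x. x \<in> S \<Longrightarrow> g x = f x" "\<And>x. \<bar>g x\<bar> \<le> K * norm x"
proof -
  define q where "q x = (INF s\<in>S. f s + K * norm (x - s))" for x
  have ne: "S \<noteq> {}" using subspace_0[OF S] by auto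
  \<comment> \<open>Finiteness of the infimum: \<open>f s\<close> is at least
    \<open>- K * norm s\<close>, and \<open>norm s\<close> is at most
    \<open>norm x + norm (x - s)\<close>.\<close>
  have "- (K * norm x) \<le> f s + K * norm (x - s)" if "s \<in> S" for s x
  proof -
    have "K * norm s \<le> K * (norm x + norm (x - s))"
      using norm_triangle_ineq4[of x "x - s"] K by (intro mult_left_mono) auto
    then show ?thesis using bound[OF that] by (simp add: distrib_left)
  qed
  then have "bdd_below ((\<lambda>s. f s + K * norm (x - s)) ` S)" for x
    by (intro bdd_belowI2[where m = "- (K * norm x)"]) auto
  then have le: "q x \<le> f s + K * norm (x - s)" if "s \<in> S" for s x
    unfolding q_def using that by (auto intro: cINF_lower)
  have "sublinear q"
  proof (rule sublinearI)
    fix x y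
    have "q (x + y) - (f s + K * norm (x - s)) \<le> q y" if s: "s \<in> S" for s
      unfolding q_def[of y]
    proof (rule cINF_greatest[OF ne])
      fix t assume t: "t \<in> S"
      have "K * norm (x + y - (s + t)) \<le> K * (norm (x - s) + norm (y - t))"
        using norm_triangle_ineq[of "x - s" "y - t"] K
        by (intro mult_left_mono) (auto simp: algebra_simps)
      then show "q (x + y) - (f s + K * norm (x - s)) \<le> f t + K * norm (y - t)"
        using le[OF subspace_add[OF S s t], of "x + y"] add[OF s t] by (simp add: distrib_left)
    qed
    then have "q (x + y) - q y \<le> q x"
      unfolding q_def[of x] by (intro cINF_greatest[OF ne]) (simp_all add: algebra_simps)
    then show "q (x + y) \<le> q x + q y" by simp
  next
    fix r :: real and x assume r: "r > 0"
    have "q (r *\<^sub>R x) / r \<le> q x"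
      unfolding q_def[of x]
    proof (rule cINF_greatest[OF ne])
      fix s assume s: "s \<in> S"
      have "norm (r *\<^sub>R x - r *\<^sub>R s) = r * norm (x - s)"
        using r by (simp flip: scaleR_diff_right)
      then show "q (r *\<^sub>R x) / r \<le> f s + K * norm (x - s)"
        using r le[OF subspace_scale[OF S s], of "r *\<^sub>R x" r] scale[OF s, of r]
        by (simp add: field_simps)
    qed
    then show "q (r *\<^sub>R x) \<le> r * q x" using r by (simp add: field_simps)
  qed
  then obtain g where g: "sublinear g" and gq: "\<And>x. g x \<le> q x"
    and gmin: "\<And>p'. sublinear p' \<Longrightarrow> (\<And>x. p' x \<le> g x) \<Longrightarrow> p' = g"
    using minimal_sublinear_exists by blast
  have lin: "linear g" by (rule minimal_sublinear_linear[OF g gmin])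
  \<comment> \<open>The competitor 0 in the infimum gives the bound by the norm, and the competitor
    \<open>s\<close> itself gives the bound by \<open>f\<close>.\<close>
  have le_norm: "g x \<le> K * norm x" for x
    using gq[of x] le[OF subspace_0[OF S], of x] scale[OF subspace_0[OF S], of 0] by simp
  have le_f: "g s \<le> f s" if "s \<in> S" for s
    using gq[of s] le[OF that, of s] by simp
  show ?thesis
  proof (rule that[OF lin])
    show "g x = f x" if "x \<in> S" for x
      using le_f[OF that] le_f[OF subspace_neg[OF S that]] scale[OF that, of "- 1"]
        linear_neg[OF lin, of x] by simp
    show "\<bar>g x\<bar> \<le> K * norm x" for x
      using le_norm[of x] le_norm[of "- x"] linear_neg[OF lin, of x] by simp
  qed
qed

section \<open>Linear extension to the closed span\<close>

text \<open>The inequality of \<open>bse_bound\<close> for values in any normed space and without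
  \<open>M > 0\<close>, so that the zero function has constant 0.\<close>

definition comb_bound ::
    "'v::complex_normed_vector set \<Rightarrow> ('v \<Rightarrow> 'w::complex_normed_vector) \<Rightarrow> real \<Rightarrow> bool"
  where "comb_bound X h M \<longleftrightarrow> (\<forall>(n::nat) \<phi> c. (\<forall>j<n. \<phi> j \<in> X) \<longrightarrow>
    norm (\<Sum>j<n. c j *\<^sub>C h (\<phi> j)) \<le> M * norm (\<Sum>j<n. c j *\<^sub>C \<phi> j))"

lemma comb_boundI:
  assumes "\<And>(n::nat) \<phi> c. (\<And>j. j < n \<Longrightarrow> \<phi> j \<in> X) \<Longrightarrow>
    norm (\<Sum>j<n. c j *\<^sub>C h (\<phi> j)) \<le> M * norm (\<Sum>j<n. c j *\<^sub>C \<phi> j)"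
  shows "comb_bound X h M"
  using assms by (simp add: comb_bound_def)

lemma comb_boundD:
  assumes "comb_bound X h M" "\<And>j::nat. j < n \<Longrightarrow> \<phi> j \<in> X"
  shows "norm (\<Sum>j<n. c j *\<^sub>C h (\<phi> j)) \<le> M * norm (\<Sum>j<n. c j *\<^sub>C \<phi> j)"
  using assms by (simp add: comb_bound_def)

lemma comb_bound_single:
  assumes "comb_bound X h M" "x \<in> X"
  shows "norm (h x) \<le> M * norm x"
  using comb_boundD[OF assms(1), of 1 "\<lambda>_. x" "\<lambda>_. 1"] assms(2) by (simp add: scaleC_one)

lemma comb_bound_mono:
  assumes "comb_bound X h M" "M \<le> M'"
  shows "comb_bound X h M'"
proof (rule comb_boundI)
  fix n :: nat and \<phi> c assume "\<And>j. j < n \<Longrightarrow> \<phi> j \<in> X"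
  then have "norm (\<Sum>j<n. c j *\<^sub>C h (\<phi> j)) \<le> M * norm (\<Sum>j<n. c j *\<^sub>C \<phi> j)"
    by (rule comb_boundD[OF assms(1)])
  also have "\<dots> \<le> M' * norm (\<Sum>j<n. c j *\<^sub>C \<phi> j)"
    using assms(2) by (rule mult_right_mono) simp
  finally show "norm (\<Sum>j<n. c j *\<^sub>C h (\<phi> j)) \<le> M' * norm (\<Sum>j<n. c j *\<^sub>C \<phi> j)" .
qed

lemma comb_bound_add:
  assumes "comb_bound X g K" "comb_bound X h M"
  shows "comb_bound X (\<lambda>x. g x + h x) (K + M)"
proof (rule comb_boundI)
  fix n :: nat and \<phi> c assume \<phi>: "\<And>j. j < n \<Longrightarrow> \<phi> j \<in> X"
  have "norm (\<Sum>j<n. c j *\<^sub>C (g (\<phi> j) + h (\<phi> j))) \<le>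
      norm (\<Sum>j<n. c j *\<^sub>C g (\<phi> j)) + norm (\<Sum>j<n. c j *\<^sub>C h (\<phi> j))"
    by (simp add: scaleC_add_right sum.distrib norm_triangle_ineq)
  also have "\<dots> \<le> K * norm (\<Sum>j<n. c j *\<^sub>C \<phi> j) + M * norm (\<Sum>j<n. c j *\<^sub>C \<phi> j)"
    by (intro add_mono comb_boundD[OF assms(1)] comb_boundD[OF assms(2)] \<phi>)
  finally show "norm (\<Sum>j<n. c j *\<^sub>C (g (\<phi> j) + h (\<phi> j))) \<le>
      (K + M) * norm (\<Sum>j<n. c j *\<^sub>C \<phi> j)"
    by (simp add: distrib_right)
qed

lemma comb_bound_scale:
  assumes "comb_bound X h M"
  shows "comb_bound X (\<lambda>x. d *\<^sub>C h x) (cmod d * M)"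
proof (rule comb_boundI)
  fix n :: nat and \<phi> c assume \<phi>: "\<And>j. j < n \<Longrightarrow> \<phi> j \<in> X"
  have "(\<Sum>j<n. c j *\<^sub>C d *\<^sub>C h (\<phi> j)) = d *\<^sub>C (\<Sum>j<n. c j *\<^sub>C h (\<phi> j))"
    by (simp add: complex_vector.scale_sum_right scaleC_scaleC mult.commute)
  then show "norm (\<Sum>j<n. c j *\<^sub>C d *\<^sub>C h (\<phi> j)) \<le> cmod d * M * norm (\<Sum>j<n. c j *\<^sub>C \<phi> j)"
    using comb_boundD[OF assms, of n \<phi> c] \<phi> by (simp add: norm_scaleC mult_left_mono mult.assoc)
qed

text \<open>The graph of the prospective linear extension of \<open>h\<close> to the span, kept as a
  relation because different combinations may represent the same vector; single-valuedness comes
  later, from the bound.\<close>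

inductive_set comb_graph :: "'v::complex_vector set \<Rightarrow> ('v \<Rightarrow> 'w::complex_vector) \<Rightarrow> ('v \<times> 'w) set"
  for X h where
    zero: "(0, 0) \<in> comb_graph X h"
  | step: "(x, y) \<in> comb_graph X h \<Longrightarrow> a \<in> X \<Longrightarrow> (c *\<^sub>C a + x, c *\<^sub>C h a + y) \<in> comb_graph X h"

lemma comb_graph_add:
  assumes "(x, y) \<in> comb_graph X h" "(x', y') \<in> comb_graph X h"
  shows "(x + x', y + y') \<in> comb_graph X h"
  using assms by (induction rule: comb_graph.induct) (simp_all add: add.assoc comb_graph.step)

lemma comb_graph_scale:
  assumes "(x, y) \<in> comb_graph X h"
  shows "(d *\<^sub>C x, d *\<^sub>C y) \<in> comb_graph X h"
  using assms
  by (induction rule: comb_graph.induct)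
    (simp_all add: comb_graph.zero comb_graph.step scaleC_add_right scaleC_scaleC)

lemma comb_graph_sum:
  assumes "\<And>j::nat. j < n \<Longrightarrow> \<phi> j \<in> X"
  shows "(\<Sum>j<n. c j *\<^sub>C \<phi> j, \<Sum>j<n. c j *\<^sub>C h (\<phi> j)) \<in> comb_graph X h"
  using assms
  by (induction n) (simp_all add: comb_graph.zero comb_graph.step add.commute)

lemma comb_graph_imp_sum:
  assumes "(x, y) \<in> comb_graph X h"
  obtains n :: nat and \<phi> c where "\<And>j. j < n \<Longrightarrow> \<phi> j \<in> X"
    "x = (\<Sum>j<n. c j *\<^sub>C \<phi> j)" "y = (\<Sum>j<n. c j *\<^sub>C h (\<phi> j))"
proof -
  have "\<exists>(n::nat) \<phi> c. (\<forall>j<n. \<phi> j \<in> X) \<and> x = (\<Sum>j<n. c j *\<^sub>C \<phi> j) \<and> y = (\<Sum>j<n. c j *\<^sub>C h (\<phi> j))"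
    using assms
  proof induction
    case zero
    then show ?case by (intro exI[of _ 0]) simp
  next
    case (step x y a d)
    then obtain n :: nat and \<phi> c where "\<forall>j<n. \<phi> j \<in> X" "x = (\<Sum>j<n. c j *\<^sub>C \<phi> j)"
      "y = (\<Sum>j<n. c j *\<^sub>C h (\<phi> j))" by blast
    with step show ?case
      by (intro exI[of _ "Suc n"] exI[of _ "\<phi>(n := a)"] exI[of _ "c(n := d)"])
        (auto simp: less_Suc_eq add.commute)
  qed
  then show ?thesis using that by blast
qed

lemma comb_graph_domain: "(\<exists>y. (x, y) \<in> comb_graph X h) \<longleftrightarrow> x \<in> cspan X"
proof
  assume "\<exists>y. (x, y) \<in> comb_graph X h"
  then obtain y where "(x, y) \<in> comb_graph X h" ..
  then show "x \<in> cspan X"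
    by induction
      (auto intro: complex_vector.span_zero complex_vector.span_add complex_vector.span_scale
        complex_vector.span_base)
next
  assume "x \<in> cspan X"
  then show "\<exists>y. (x, y) \<in> comb_graph X h"
  proof (induction rule: complex_vector.span_induct_alt)
    case base
    show ?case using comb_graph.zero[of X h] by blast
  next
    case (step c a x)
    then show ?case using comb_graph.step[of x _ X h a c] by blast
  qed
qed

lemma cspan_sum:
  assumes "x \<in> cspan X"
  obtains n :: nat and \<phi> c where "\<And>j. j < n \<Longrightarrow> \<phi> j \<in> X" "x = (\<Sum>j<n. c j *\<^sub>C \<phi> j)"
  using assms comb_graph_imp_sum[of x _ X "\<lambda>x. x"] comb_graph_domain[of x X "\<lambda>x. x"] by metis

lemma csubspace_closure:
  fixes S :: "'v::complex_normed_vector set"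
  assumes "csubspace S"
  shows "csubspace (closure S)"
  unfolding complex_vector.subspace_def
proof (intro conjI ballI allI)
  show "0 \<in> closure S"
    using complex_vector.subspace_0[OF assms] closure_subset by blast
next
  fix x y assume "x \<in> closure S" "y \<in> closure S"
  then obtain X Y where "\<And>n::nat. X n \<in> S" "X \<longlonglongrightarrow> x" "\<And>n::nat. Y n \<in> S" "Y \<longlonglongrightarrow> y"
    by (auto simp: closure_sequential)
  then show "x + y \<in> closure S"
    unfolding closure_sequential
    by (intro exI[of _ "\<lambda>n. X n + Y n"] conjI allI tendsto_add complex_vector.subspace_add[OF assms])
next
  fix c x assume "x \<in> closure S"
  then obtain X where "\<And>n::nat. X n \<in> S" "X \<longlonglongrightarrow> x"
    by (auto simp: closure_sequential)
  then show "c *\<^sub>C x \<in> closure S"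
    unfolding closure_sequential
    by (intro exI[of _ "\<lambda>n. c *\<^sub>C X n"] conjI allI complex_vector.subspace_scale[OF assms]
        bounded_linear.tendsto[OF bounded_linear_scaleC])
qed

text \<open>The bound makes the graph single-valued and the resulting map Lipschitz, hence uniformly
  continuous; completeness of the target then carries it to the closure.\<close>

lemma closed_cspan_extension:
  fixes h :: "'v::complex_normed_vector \<Rightarrow> 'w::{complex_normed_vector, banach}"
  assumes h: "comb_bound X h M" and M: "M \<ge> 0"
  obtains G where "continuous_on (closure (cspan X)) G"
    "\<And>x y. x \<in> closure (cspan X) \<Longrightarrow> y \<in> closure (cspan X) \<Longrightarrow> G (x + y) = G x + G y"
    "\<And>c x. x \<in> closure (cspan X) \<Longrightarrow> G (c *\<^sub>C x) = c *\<^sub>C G x"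
    "\<And>x. x \<in> closure (cspan X) \<Longrightarrow> norm (G x) \<le> M * norm x"
    "\<And>(n::nat) \<phi> c. \<forall>j<n. \<phi> j \<in> X \<Longrightarrow>
      G (\<Sum>j<n. c j *\<^sub>C \<phi> j) = (\<Sum>j<n. c j *\<^sub>C h (\<phi> j))"
proof -
  let ?S = "cspan X" and ?R = "comb_graph X h"
  have R_bound: "norm y \<le> M * norm x" if "(x, y) \<in> ?R" for x y
    using that by (rule comb_graph_imp_sum) (auto intro: comb_boundD[OF h])
  define G0 where "G0 x = (SOME y. (x, y) \<in> ?R)" for x
  have G0_mem: "(x, G0 x) \<in> ?R" if "x \<in> ?S" for x
    unfolding G0_def using that by (auto simp flip: comb_graph_domain[of x X h] intro: someI)
  have R_diff: "(x - x', y - y') \<in> ?R" if "(x, y) \<in> ?R" "(x', y') \<in> ?R" for x y x' y'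
    using comb_graph_add[OF that(1) comb_graph_scale[OF that(2), of "-1"]] by simp
  \<comment> \<open>Two values over the same \<open>x\<close> differ by a value over 0, which the
    bound forces to vanish.\<close>
  have G0_eq: "G0 x = y" if "(x, y) \<in> ?R" for x y
  proof -
    have "x \<in> ?S" using that by (auto simp flip: comb_graph_domain[of x X h])
    from R_bound[OF R_diff[OF G0_mem[OF this] that]] show ?thesis by simp
  qed
  have "uniformly_continuous_on ?S G0"
  unfolding uniformly_continuous_on_def
  proof (intro allI impI)
    fix e :: real assume e: "e > 0"
    \<comment> \<open>Division by \<open>M + 1\<close> instead of \<open>M\<close>, because
      \<open>M\<close> may be 0.\<close>
    have "dist (G0 x') (G0 x) < e" if "x \<in> ?S" "x' \<in> ?S" "dist x' x < e / (M + 1)" for x x'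
    proof -
      have "norm (G0 x' - G0 x) \<le> M * norm (x' - x)"
        by (rule R_bound[OF R_diff[OF G0_mem G0_mem]]) (use that in auto)
      also have "\<dots> \<le> (M + 1) * norm (x' - x)" by (simp add: distrib_right)
      also have "\<dots> < e" using that(3) M by (simp add: dist_norm field_simps)
      finally show ?thesis by (simp add: dist_norm)
    qed
    then show "\<exists>d>0. \<forall>x\<in>?S. \<forall>x'\<in>?S. dist x' x < d \<longrightarrow> dist (G0 x') (G0 x) < e"
      using e M by (intro exI[of _ "e / (M + 1)"]) auto
  qed
  then obtain G where uG: "uniformly_continuous_on (closure ?S) G"
    and GG0: "\<And>x. x \<in> ?S \<Longrightarrow> G0 x = G x"
    by (rule uniformly_continuous_on_extension_on_closure) blast
  have cont: "continuous_on (closure ?S) G"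
    using uG by (rule uniformly_continuous_imp_continuous)
  have GR: "G x = y" if "(x, y) \<in> ?R" for x y
  proof -
    have "x \<in> ?S" using that by (auto simp flip: comb_graph_domain[of x X h])
    with GG0 G0_eq[OF that] show ?thesis by simp
  qed
  have G_mem: "(x, G x) \<in> ?R" if "x \<in> ?S" for x
    using G0_mem[OF that] GG0[OF that] by simp
  \<comment> \<open>All properties on the closure are obtained from those on the span along
    approximating sequences.\<close>
  have lim: "(\<lambda>n. G (u n)) \<longlonglongrightarrow> G x" if "\<And>n. u n \<in> ?S" "u \<longlonglongrightarrow> x" for u x
  proof (rule continuous_on_tendsto_compose[OF cont that(2)])
    show "x \<in> closure ?S" using that by (auto simp: closure_sequential)
    show "\<forall>\<^sub>F n in sequentially. u n \<in> closure ?S"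
      using that(1) closure_subset by (intro always_eventually) blast
  qed
  show ?thesis
  proof (rule that[OF cont])
    fix x y assume "x \<in> closure ?S" "y \<in> closure ?S"
    then obtain u v where u: "\<And>n::nat. u n \<in> ?S" "u \<longlonglongrightarrow> x" and v: "\<And>n::nat. v n \<in> ?S" "v \<longlonglongrightarrow> y"
      by (auto simp: closure_sequential)
    have "G (u n + v n) = G (u n) + G (v n)" for n
      by (rule GR[OF comb_graph_add[OF G_mem G_mem]]) (use u v in auto)
    moreover have "(\<lambda>n. G (u n + v n)) \<longlonglongrightarrow> G (x + y)"
      using u v by (intro lim complex_vector.span_add tendsto_add)
    ultimately show "G (x + y) = G x + G y"
      using tendsto_add[OF lim[OF u] lim[OF v]] by (auto intro: LIMSEQ_unique)
  next
    fix c x assume "x \<in> closure ?S"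
    then obtain u where u: "\<And>n::nat. u n \<in> ?S" "u \<longlonglongrightarrow> x"
      by (auto simp: closure_sequential)
    have "G (c *\<^sub>C u n) = c *\<^sub>C G (u n)" for n
      by (rule GR[OF comb_graph_scale[OF G_mem]]) (use u in auto)
    moreover have "(\<lambda>n. G (c *\<^sub>C u n)) \<longlonglongrightarrow> G (c *\<^sub>C x)"
      using u by (intro lim complex_vector.span_scale bounded_linear.tendsto[OF bounded_linear_scaleC])
    ultimately show "G (c *\<^sub>C x) = c *\<^sub>C G x"
      using bounded_linear.tendsto[OF bounded_linear_scaleC lim[OF u]] by (auto intro: LIMSEQ_unique)
  next
    fix x assume "x \<in> closure ?S"
    then obtain u where u: "\<And>n::nat. u n \<in> ?S" "u \<longlonglongrightarrow> x"
      by (auto simp: closure_sequential)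
    show "norm (G x) \<le> M * norm x"
      using u by (intro LIMSEQ_le[OF tendsto_norm[OF lim[OF u]]
            tendsto_mult_left[OF tendsto_norm[OF u(2)]]]) (auto intro: R_bound G_mem)
  next
    fix n :: nat and \<phi> c assume "\<forall>j<n. \<phi> j \<in> X"
    then show "G (\<Sum>j<n. c j *\<^sub>C \<phi> j) = (\<Sum>j<n. c j *\<^sub>C h (\<phi> j))"
      by (intro GR comb_graph_sum) simp
  qed
qed

section \<open>Functionals on a subspace\<close>

lemma dual_onD:
  assumes "F \<in> dual_on P"
  shows "x \<notin> P \<Longrightarrow> F x = 0"
    and "x \<in> P \<Longrightarrow> y \<in> P \<Longrightarrow> F (x + y) = F x + F y"
    and "x \<in> P \<Longrightarrow> F (c *\<^sub>C x) = c * F x"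
  using assms by (auto simp: dual_on_def)

lemma dual_onI:
  assumes "\<And>x. x \<notin> P \<Longrightarrow> F x = 0" "\<And>x y. x \<in> P \<Longrightarrow> y \<in> P \<Longrightarrow> F (x + y) = F x + F y"
    "\<And>c x. x \<in> P \<Longrightarrow> F (c *\<^sub>C x) = c * F x" "\<And>x. x \<in> P \<Longrightarrow> cmod (F x) \<le> K * norm x"
  shows "F \<in> dual_on P"
  using assms unfolding dual_on_def by blast

lemma dual_on_bounded:
  assumes "F \<in> dual_on P"
  obtains K where "K \<ge> 0" "\<And>x. x \<in> P \<Longrightarrow> cmod (F x) \<le> K * norm x"
proof -
  obtain K where K: "\<And>x. x \<in> P \<Longrightarrow> cmod (F x) \<le> K * norm x"
    using assms unfolding dual_on_def by blast
  show ?thesis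
  proof (rule that[of "\<bar>K\<bar>"])
    show "cmod (F x) \<le> \<bar>K\<bar> * norm x" if "x \<in> P" for x
      using K[OF that] by (rule order_trans) (auto intro: mult_right_mono)
  qed simp
qed

lemma dual_on_diff:
  assumes "csubspace P" "F \<in> dual_on P" "x \<in> P" "y \<in> P"
  shows "F (x - y) = F x - F y"
proof -
  have "(- 1) *\<^sub>C y \<in> P" by (rule complex_vector.subspace_scale) (use assms in auto)
  then have "F (x + (- 1) *\<^sub>C y) = F x + (- 1) * F y"
    using assms by (simp only: dual_onD)
  then show ?thesis by simp
qed

lemma dual_on_tendsto:
  assumes P: "csubspace P" and F: "F \<in> dual_on P" and "\<And>n::nat. u n \<in> P" "x \<in> P" "u \<longlonglongrightarrow> x"
  shows "(\<lambda>n. F (u n)) \<longlonglongrightarrow> F x"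
proof -
  obtain K where K: "\<And>x. x \<in> P \<Longrightarrow> cmod (F x) \<le> K * norm x"
    using dual_on_bounded[OF F] by blast
  have "(\<lambda>n. F (u n) - F x) \<longlonglongrightarrow> 0"
  proof (rule Lim_null_comparison)
    show "\<forall>\<^sub>F n in sequentially. norm (F (u n) - F x) \<le> K * norm (u n - x)"
      using assms K complex_vector.subspace_diff[OF P]
      by (intro always_eventually allI) (simp flip: dual_on_diff[OF P F])
    show "(\<lambda>n. K * norm (u n - x)) \<longlonglongrightarrow> 0"
      using tendsto_mult_left[OF tendsto_norm_zero[OF LIM_zero[OF assms(5)]], of K] by simp
  qed
  then show ?thesis by (rule LIM_zero_cancel)
qed

lemma dual_on_sum:
  assumes P: "csubspace P" and F: "F \<in> dual_on P" and "\<And>j::nat. j < n \<Longrightarrow> \<phi> j \<in> P"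
  shows "F (\<Sum>j<n. c j *\<^sub>C \<phi> j) = (\<Sum>j<n. c j * F (\<phi> j))"
  using assms(3)
proof (induction n)
  case 0
  have "F (0 *\<^sub>C 0) = 0 * F 0"
    by (rule dual_onD(3)[OF F]) (rule complex_vector.subspace_0[OF P])
  then show ?case by simp
next
  case (Suc n)
  have "(\<Sum>j<n. c j *\<^sub>C \<phi> j) \<in> P"
    using Suc.prems
    by (intro complex_vector.subspace_sum[OF P] complex_vector.subspace_scale[OF P]) auto
  moreover have "c n *\<^sub>C \<phi> n \<in> P"
    using Suc.prems by (intro complex_vector.subspace_scale[OF P]) auto
  ultimately show ?case
    using Suc by (simp add: dual_onD[OF F])
qed

lemma csubspace_imp_subspace:
  fixes S :: "'v::complex_normed_vector set"
  shows "csubspace S \<Longrightarrow> subspace S"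
  by (simp add: subspace_def complex_vector.subspace_def scaleR_scaleC)

text \<open>The real part is extended first; a complex-linear functional is recovered from its real
  part \<open>g\<close> as \<open>g x - i g (i x)\<close>. The constant doubles, which is harmless,
  since only membership in the dual is claimed.\<close>

lemma dual_on_extend:
  fixes f :: "'v::complex_normed_vector \<Rightarrow> complex"
  assumes P: "csubspace P" and f: "f \<in> dual_on P"
  obtains g where "g \<in> dual_on UNIV" "\<And>x. x \<in> P \<Longrightarrow> g x = f x"
proof -
  obtain K0 where K0: "\<And>x. x \<in> P \<Longrightarrow> cmod (f x) \<le> K0 * norm x"
    using f unfolding dual_on_def by blast
  define K where "K = \<bar>K0\<bar>"
  have K: "cmod (f x) \<le> K * norm x" if "x \<in> P" for x
    using K0[OF that] by (rule order_trans) (auto simp: K_def intro: mult_right_mono)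
  have fadd: "f (x + y) = f x + f y" if "x \<in> P" "y \<in> P" for x y
    using f that by (auto simp: dual_on_def)
  have fsc: "f (c *\<^sub>C x) = c * f x" if "x \<in> P" for c x
    using f that by (auto simp: dual_on_def)
  obtain g where lin: "linear g" and gf: "\<And>x. x \<in> P \<Longrightarrow> g x = Re (f x)"
    and gK: "\<And>x. \<bar>g x\<bar> \<le> K * norm x"
  proof (rule hahn_banach_real[of P "\<lambda>x. Re (f x)" K])
    show "\<bar>Re (f x)\<bar> \<le> K * norm x" if "x \<in> P" for x
      using K[OF that] abs_Re_le_cmod[of "f x"] by linarith
  qed (use P in \<open>auto simp: csubspace_imp_subspace fadd fsc scaleR_scaleC K_def\<close>)
  define G where "G x = Complex (g x) (- g (\<i> *\<^sub>C x))" for x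
  have scale: "g (c *\<^sub>C x) = Re c * g x + Im c * g (\<i> *\<^sub>C x)" for c x
  proof -
    have "c *\<^sub>C x = Re c *\<^sub>R x + Im c *\<^sub>R (\<i> *\<^sub>C x)"
      by (simp add: scaleR_scaleC scaleC_scaleC flip: scaleC_add_left)
        (simp add: complex_eq mult.commute)
    then show ?thesis
      by (simp add: linear_add[OF lin] linear_scale[OF lin])
  qed
  show ?thesis
  proof (rule that[of G])
    have "cmod (G x) \<le> 2 * K * norm x" for x
      using cmod_le[of "G x"] gK[of x] gK[of "\<i> *\<^sub>C x"] by (simp add: G_def norm_scaleC)
    moreover have "G (x + y) = G x + G y" for x y
      by (simp add: G_def scaleC_add_right linear_add[OF lin] complex_eq_iff)
    moreover have "G (c *\<^sub>C x) = c * G x" for c x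
      by (simp add: G_def scaleC_scaleC complex_eq_iff scale[of c] scale[of "\<i> * c"])
    ultimately show "G \<in> dual_on UNIV"
      by (auto simp: dual_on_def)
    show "G x = f x" if "x \<in> P" for x
    proof -
      have "\<i> *\<^sub>C x \<in> P" using P that by (simp add: complex_vector.subspace_def)
      then show ?thesis using that by (simp add: G_def gf fsc complex_eq_iff)
    qed
  qed
qed

text \<open>Linearity settles the span and continuity its closure. Outside \<open>P\<close> both
  functionals are 0 by convention, so they agree as functions on the whole type.\<close>

lemma dual_on_cspan_eqI:
  fixes X :: "'v::complex_normed_vector set"
  defines "P \<equiv> closure (cspan X)"
  assumes F: "F \<in> dual_on P" and G: "G \<in> dual_on P" and eq: "\<And>x. x \<in> X \<Longrightarrow> F x = G x"
  shows "F = G"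
proof
  fix x
  have P: "csubspace P" unfolding P_def by (intro csubspace_closure complex_vector.subspace_span)
  have SP: "cspan X \<subseteq> P" unfolding P_def by (rule closure_subset)
  have XP: "X \<subseteq> P" using SP complex_vector.span_superset by blast
  show "F x = G x"
  proof (cases "x \<in> P")
    case True
    then obtain u where u: "\<And>n::nat. u n \<in> cspan X" "u \<longlonglongrightarrow> x"
      by (auto simp: P_def closure_sequential)
    have "F y = G y" if "y \<in> cspan X" for y
      using that
    proof (rule cspan_sum)
      fix n :: nat and \<phi> c assume "\<And>j. j < n \<Longrightarrow> \<phi> j \<in> X" "y = (\<Sum>j<n. c j *\<^sub>C \<phi> j)"
      then show ?thesis
        using XP by (auto simp: dual_on_sum[OF P F] dual_on_sum[OF P G] eq subset_iff)
    qed
    then have "(\<lambda>n. G (u n)) = (\<lambda>n. F (u n))" using u by simp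
    moreover have "(\<lambda>n. F (u n)) \<longlonglongrightarrow> F x" "(\<lambda>n. G (u n)) \<longlonglongrightarrow> G x"
      using u SP True by (auto intro!: dual_on_tendsto[OF P F] dual_on_tendsto[OF P G])
    ultimately show ?thesis by (auto intro: LIMSEQ_unique)
  qed (simp add: dual_onD(1)[OF F] dual_onD(1)[OF G])
qed

text \<open>A real supremum dominates its members only if the set is bounded above; membership in
  \<open>dual_on\<close> guarantees this.\<close>

lemma cmod_le_dual_norm_on:
  assumes F: "F \<in> dual_on P" and "x \<in> P" "norm x \<le> 1"
  shows "cmod (F x) \<le> dual_norm_on P F"
proof -
  obtain K where K: "K \<ge> 0" "\<And>x. x \<in> P \<Longrightarrow> cmod (F x) \<le> K * norm x"
    using dual_on_bounded[OF F] by blast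
  have "cmod (F y) \<le> K" if "y \<in> P" "norm y \<le> 1" for y
    using K(2)[OF that(1)] mult_left_mono[OF that(2) K(1)] by simp
  then have "bdd_above ((\<lambda>x. cmod (F x)) ` {x \<in> P. norm x \<le> 1})"
    by (intro bdd_aboveI2[where M = K]) auto
  then show ?thesis
    unfolding dual_norm_on_def using assms(2,3) by (intro cSUP_upper) auto
qed

lemma dual_norm_on_nonneg:
  assumes "csubspace P" "F \<in> dual_on P"
  shows "0 \<le> dual_norm_on P F"
  using cmod_le_dual_norm_on[OF assms(2) complex_vector.subspace_0[OF assms(1)]]
  by (auto intro: order_trans[OF norm_ge_zero])

lemma dual_norm_on_bound:
  assumes P: "csubspace P" and F: "F \<in> dual_on P" and x: "x \<in> P"
  shows "cmod (F x) \<le> dual_norm_on P F * norm x"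
proof (cases "x = 0")
  case True
  obtain K where "\<And>x. x \<in> P \<Longrightarrow> cmod (F x) \<le> K * norm x"
    using dual_on_bounded[OF F] by blast
  from this[OF x] show ?thesis using True by simp
next
  case False
  have "cmod (F (complex_of_real (inverse (norm x)) *\<^sub>C x)) \<le> dual_norm_on P F"
    using complex_vector.subspace_scale[OF P x] False
    by (intro cmod_le_dual_norm_on[OF F]) (simp_all add: norm_scaleC norm_inverse norm_divide)
  then show ?thesis
    using False by (simp add: dual_onD(3)[OF F x] norm_mult norm_inverse norm_divide field_simps)
qed

lemma dual_norm_on_le:
  assumes "csubspace P" "M \<ge> 0" "\<And>x. x \<in> P \<Longrightarrow> cmod (F x) \<le> M * norm x"
  shows "dual_norm_on P F \<le> M"
  unfolding dual_norm_on_def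
proof (rule cSUP_least)
  show "{x \<in> P. norm x \<le> 1} \<noteq> {}"
    using complex_vector.subspace_0[OF assms(1)] norm_zero zero_le_one by fastforce
  show "cmod (F x) \<le> M" if "x \<in> {x \<in> P. norm x \<le> 1}" for x
    using that assms(3)[of x] mult_left_mono[of "norm x" 1 M] assms(2) by auto
qed

section \<open>Initial topologies\<close>

text \<open>Any one member of \<open>Fs\<close> exhibits \<open>X\<close> as the preimage of
  \<open>UNIV\<close>; an empty family would generate the empty space.\<close>

lemma topspace_initial_topology_on:
  assumes "Fs \<noteq> {}"
  shows "topspace (initial_topology_on X Fs) = X"
proof -
  obtain f where "f \<in> Fs" using assms by blast
  then have "{x \<in> X. f x \<in> UNIV} \<in> {{x \<in> X. f x \<in> U} |f U. f \<in> Fs \<and> open U}"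
    using open_UNIV by blast
  then show ?thesis
    unfolding initial_topology_on_def topology_generated_by_topspace by auto
qed

lemma continuous_map_initial_topology_on:
  assumes "f \<in> Fs"
  shows "continuous_map (initial_topology_on X Fs) euclidean f"
proof -
  have X: "topspace (initial_topology_on X Fs) = X"
    using assms by (intro topspace_initial_topology_on) auto
  have "openin (initial_topology_on X Fs) {x \<in> X. f x \<in> U}" if "open U" for U
    unfolding initial_topology_on_def
    using assms that by (intro topology_generated_by_Basis) blast
  then show ?thesis
    by (simp add: continuous_map_def X)
qed

lemma continuous_map_into_initial_topology_on:
  assumes "Fs \<noteq> {}" "g \<in> topspace T \<rightarrow> X" "\<And>f. f \<in> Fs \<Longrightarrow> continuous_map T euclidean (\<lambda>x. f (g x))"
  shows "continuous_map T (initial_topology_on X Fs) g"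
  unfolding initial_topology_on_def
proof (rule continuous_on_generated_topo)
  fix V assume "V \<in> {{x \<in> X. f x \<in> U} |f U. f \<in> Fs \<and> open U}"
  then obtain f U where V: "V = {x \<in> X. f x \<in> U}" "f \<in> Fs" "open U" by blast
  have "g -` V \<inter> topspace T = {x \<in> topspace T. f (g x) \<in> U}"
    using assms(2) V(1) by auto
  then show "openin T (g -` V \<inter> topspace T)"
    using assms(3)[OF V(2)] V(3) by (simp add: continuous_map_def)
next
  show "g ` topspace T \<subseteq> \<Union> {{x \<in> X. f x \<in> U} |f U. f \<in> Fs \<and> open U}"
    using assms(2) topspace_initial_topology_on[OF assms(1), of X]
    unfolding initial_topology_on_def topology_generated_by_topspace by auto
qed

section \<open>BSE-functions\<close>

text \<open>Multiplicativity on squares gives \<open>norm \<phi> \<le> sqrt (norm \<phi>)\<close>,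
  and a nonzero norm can be cancelled.\<close>

lemma norm_character_le_one:
  fixes \<phi> :: "'a::complex_normed_algebra \<Rightarrow>\<^sub>L complex"
  assumes "\<phi> \<in> character_space"
  shows "norm \<phi> \<le> 1"
proof -
  have "norm \<phi> \<le> sqrt (norm \<phi>)"
  proof (rule norm_blinfun_bound)
    fix x
    have "(cmod (\<phi> x))\<^sup>2 = cmod (\<phi> (x * x))"
      using assms by (simp add: character_space_def norm_mult power2_eq_square)
    also have "\<dots> \<le> norm \<phi> * norm (x * x)" by (rule norm_blinfun)
    also have "\<dots> \<le> norm \<phi> * (norm x * norm x)"
      by (intro mult_left_mono norm_mult_ineq) simp
    also have "\<dots> = (sqrt (norm \<phi>) * norm x)\<^sup>2"
      by (simp add: power_mult_distrib power2_eq_square[of "norm x"])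
    finally show "norm (\<phi> x) \<le> sqrt (norm \<phi>) * norm x"
      by (rule power2_le_imp_le) simp
  qed simp
  then have "norm \<phi> * norm \<phi> \<le> norm \<phi> * 1"
    using power_mono[of "norm \<phi>" "sqrt (norm \<phi>)" 2] by (simp add: power2_eq_square)
  moreover have "norm \<phi> > 0" using assms by (simp add: character_space_def)
  ultimately show ?thesis by (simp only: mult_le_cancel_left_pos)
qed

section \<open>The BSE norm as an optimal constant\<close>

lemma bse_bound_iff: "bse_bound \<sigma> M \<longleftrightarrow> M > 0 \<and> comb_bound character_space \<sigma> M"
  by (simp add: bse_bound_def comb_bound_def)

lemma bse_norm_nonneg:
  assumes "bse_bound \<sigma> M"
  shows "0 \<le> bse_norm \<sigma>"
  unfolding bse_norm_def using assms
  by (intro cInf_greatest) (auto simp: bse_bound_iff)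

text \<open>Constants in \<open>bse_bound\<close> are strictly positive, so \<open>M = 0\<close> is
  reached only as the limit of \<open>M + e\<close>.\<close>

lemma bse_norm_le:
  assumes "comb_bound character_space \<sigma> M" "M \<ge> 0"
  shows "bse_norm \<sigma> \<le> M"
proof (rule field_le_epsilon)
  fix e :: real assume "e > 0"
  then have "bse_bound \<sigma> (M + e)"
    using assms comb_bound_mono[of character_space \<sigma> M "M + e"] by (simp add: bse_bound_iff)
  moreover have "bdd_below {M. bse_bound \<sigma> M}"
    by (rule bdd_belowI[of _ 0]) (simp add: bse_bound_iff)
  ultimately show "bse_norm \<sigma> \<le> M + e"
    unfolding bse_norm_def by (intro cInf_lower) auto
qed

text \<open>For a fixed combination the admissible constants form a closed condition, so the
  inequality survives the infimum. A vanishing combination is treated apart because the argument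
  divides by its norm.\<close>

lemma comb_bound_bse_norm:
  assumes "bse_bound \<sigma> M"
  shows "comb_bound character_space \<sigma> (bse_norm \<sigma>)"
proof (rule comb_boundI)
  fix n :: nat and \<phi> c assume \<phi>: "\<And>j. j < n \<Longrightarrow> \<phi> j \<in> (character_space :: ('a \<Rightarrow>\<^sub>L complex) set)"
  let ?y = "\<Sum>j<n. c j *\<^sub>C \<sigma> (\<phi> j)" and ?x = "\<Sum>j<n. c j *\<^sub>C \<phi> j"
  have le: "norm ?y \<le> M' * norm ?x" if "bse_bound \<sigma> M'" for M'
    using that \<phi> by (intro comb_boundD) (auto simp: bse_bound_iff)
  show "norm ?y \<le> bse_norm \<sigma> * norm ?x"
  proof (cases "?x = 0")
    case True
    then show ?thesis using le[OF assms] by simp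
  next
    case False
    then have "norm ?y / norm ?x \<le> bse_norm \<sigma>"
      unfolding bse_norm_def using assms le by (intro cInf_greatest) (auto simp: divide_le_eq)
    then show ?thesis using False by (simp add: divide_le_eq)
  qed
qed

section \<open>Multiplication by a BSE-function\<close>

lemma blinfun_apply_scaleC_sum:
  "blinfun_apply (\<Sum>j<(n::nat). c j *\<^sub>C f j) x = (\<Sum>j<n. c j * blinfun_apply (f j) x)"
  for f :: "nat \<Rightarrow> 'a::real_normed_vector \<Rightarrow>\<^sub>L complex"
  by (simp add: blinfun.sum_left scaleC_blinfun.rep_eq)

text \<open>Multiplication by a BSE-function maps \<open>\<Sum> c\<^sub>j \<phi>\<^sub>j\<close> to a functional whose value at \<open>a\<close> is
  \<open>\<sigma>\<close> applied to \<open>b \<mapsto> \<Sum> c\<^sub>j \<phi>\<^sub>j (a b)\<close>, by multiplicativity of the characters.\<close>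

lemma comb_bound_multiplier:
  fixes \<sigma> :: "('a::complex_normed_algebra \<Rightarrow>\<^sub>L complex) \<Rightarrow> complex"
  assumes \<sigma>: "comb_bound character_space \<sigma> M" and M: "M \<ge> 0"
  shows "comb_bound character_space (\<lambda>\<phi>. \<sigma> \<phi> *\<^sub>C \<phi>) M"
proof (rule comb_boundI)
  fix n :: nat and \<phi> c assume \<phi>: "\<And>j. j < n \<Longrightarrow> \<phi> j \<in> (character_space :: ('a \<Rightarrow>\<^sub>L complex) set)"
  let ?p = "\<Sum>j<n. c j *\<^sub>C \<phi> j"
  show "norm (\<Sum>j<n. c j *\<^sub>C \<sigma> (\<phi> j) *\<^sub>C \<phi> j) \<le> M * norm ?p"
  proof (rule norm_blinfun_bound)
    fix a
    let ?q = "\<Sum>j<n. (c j * \<phi> j a) *\<^sub>C \<phi> j"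
    have "norm ?q \<le> norm ?p * norm a"
    proof (rule norm_blinfun_bound)
      fix b
      have "?q b = ?p (a * b)"
        unfolding blinfun_apply_scaleC_sum
        using \<phi> by (intro sum.cong) (auto simp: character_space_def)
      then show "norm (?q b) \<le> norm ?p * norm a * norm b"
        using norm_blinfun[of ?p "a * b"] mult_left_mono[OF norm_mult_ineq[of a b], of "norm ?p"]
        by (simp add: mult.assoc)
    qed simp
    then have q: "M * norm ?q \<le> M * norm ?p * norm a"
      using M by (simp add: mult_left_mono mult.assoc)
    \<comment> \<open>Evaluation at \<open>a\<close> moves the scalars \<open>\<phi> j a\<close>
      into the coefficients, so that the bound for \<open>\<sigma>\<close> applies to
      \<open>?q\<close>.\<close>
    have "norm ((\<Sum>j<n. c j *\<^sub>C \<sigma> (\<phi> j) *\<^sub>C \<phi> j) a) =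
        norm (\<Sum>j<n. (c j * \<phi> j a) *\<^sub>C \<sigma> (\<phi> j))"
      by (simp add: scaleC_scaleC blinfun_apply_scaleC_sum mult_ac)
    also have "\<dots> \<le> M * norm ?q"
      by (rule comb_boundD[OF \<sigma> \<phi>])
    also note q
    finally show "norm ((\<Sum>j<n. c j *\<^sub>C \<sigma> (\<phi> j) *\<^sub>C \<phi> j) a) \<le> M * norm ?p * norm a" .
  qed (simp add: M)
qed

text \<open>The values of \<open>\<tau>\<close> are absorbed into the coefficients; what remains is
  the norm of the multiplied combination, controlled by
  \<open>comb_bound_multiplier\<close>.\<close>

lemma comb_bound_mult:
  fixes \<sigma> \<tau> :: "('a::complex_normed_algebra \<Rightarrow>\<^sub>L complex) \<Rightarrow> complex"
  assumes \<sigma>: "comb_bound character_space \<sigma> M" "M \<ge> 0"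
    and \<tau>: "comb_bound character_space \<tau> K" "K \<ge> 0"
  shows "comb_bound character_space (\<lambda>\<phi>. \<sigma> \<phi> * \<tau> \<phi>) (M * K)"
proof (rule comb_boundI)
  fix n :: nat and \<phi> c assume \<phi>: "\<And>j. j < n \<Longrightarrow> \<phi> j \<in> (character_space :: ('a \<Rightarrow>\<^sub>L complex) set)"
  have "norm (\<Sum>j<n. c j *\<^sub>C (\<sigma> (\<phi> j) * \<tau> (\<phi> j))) = norm (\<Sum>j<n. (c j * \<tau> (\<phi> j)) *\<^sub>C \<sigma> (\<phi> j))"
    by (simp add: mult_ac)
  also have "\<dots> \<le> M * norm (\<Sum>j<n. (c j * \<tau> (\<phi> j)) *\<^sub>C \<phi> j)"
    by (rule comb_boundD[OF \<sigma>(1) \<phi>])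
  also have "\<dots> = M * norm (\<Sum>j<n. c j *\<^sub>C \<tau> (\<phi> j) *\<^sub>C \<phi> j)"
    by (simp add: scaleC_scaleC)
  also have "\<dots> \<le> M * (K * norm (\<Sum>j<n. c j *\<^sub>C \<phi> j))"
    by (intro mult_left_mono comb_boundD[OF comb_bound_multiplier[OF \<tau>] \<phi>] \<sigma>(2))
  finally show "norm (\<Sum>j<n. c j *\<^sub>C (\<sigma> (\<phi> j) * \<tau> (\<phi> j))) \<le> M * K * norm (\<Sum>j<n. c j *\<^sub>C \<phi> j)"
    by (simp add: mult.assoc)
qed

lemma comb_bound_imp_bse_bound:
  assumes "comb_bound character_space \<sigma> M"
  shows "bse_bound \<sigma> (max 1 M)"
  using comb_bound_mono[OF assms, of "max 1 M"] by (simp add: bse_bound_iff)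

section \<open>The predual and the extension of BSE-functions\<close>

lemma csubspace_bse_predual: "csubspace bse_predual"
  unfolding bse_predual_def by (intro csubspace_closure complex_vector.subspace_span)

lemma cspan_subset_bse_predual: "cspan character_space \<subseteq> bse_predual"
  unfolding bse_predual_def by (rule closure_subset)

lemma character_space_subset_bse_predual: "character_space \<subseteq> bse_predual"
  using cspan_subset_bse_predual complex_vector.span_superset by blast

lemma is_bse_extension_iff:
  "is_bse_extension \<sigma> F \<longleftrightarrow> F \<in> dual_on bse_predual \<and> (\<forall>\<phi>\<in>character_space. F \<phi> = \<sigma> \<phi>)"
proof (intro iffI conjI ballI; (elim conjE)?)
  fix \<phi> :: "'a \<Rightarrow>\<^sub>L complex" assume ext: "is_bse_extension \<sigma> F" and \<phi>: "\<phi> \<in> character_space"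
  have "F (\<Sum>k<n. c k *\<^sub>C \<psi> k) = (\<Sum>k<n. c k * \<sigma> (\<psi> k))"
    if "\<forall>k<n. \<psi> k \<in> character_space" for n :: nat and \<psi> c
    using ext that by (simp add: is_bse_extension_def)
  from this[of 1 "\<lambda>_. \<phi>" "\<lambda>_. 1"] \<phi> show "F \<phi> = \<sigma> \<phi>" by (simp add: scaleC_one)
next
  assume F: "F \<in> dual_on bse_predual" and eq: "\<forall>\<phi>\<in>character_space. F \<phi> = \<sigma> \<phi>"
  show "is_bse_extension \<sigma> F"
    unfolding is_bse_extension_def
  proof (intro conjI allI impI F)
    fix n :: nat and \<phi> c assume \<phi>: "\<forall>k<n. \<phi> k \<in> (character_space :: ('a \<Rightarrow>\<^sub>L complex) set)"
    then have "F (\<Sum>k<n. c k *\<^sub>C \<phi> k) = (\<Sum>k<n. c k * F (\<phi> k))"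
      using character_space_subset_bse_predual
      by (intro dual_on_sum[OF csubspace_bse_predual F]) auto
    then show "F (\<Sum>k<n. c k *\<^sub>C \<phi> k) = (\<Sum>k<n. c k * \<sigma> (\<phi> k))"
      using eq \<phi> by simp
  qed
qed (simp add: is_bse_extension_def)

lemma is_bse_extension_unique:
  assumes "is_bse_extension \<sigma> F" "is_bse_extension \<sigma> G"
  shows "F = G"
  using assms dual_on_cspan_eqI[of F character_space G]
  by (auto simp: is_bse_extension_iff bse_predual_def)

lemma bse_extension_eqI: "is_bse_extension \<sigma> F \<Longrightarrow> bse_extension \<sigma> = F"
  unfolding bse_extension_def by (auto intro: is_bse_extension_unique)

lemma is_bse_extension_exists:
  assumes \<sigma>: "comb_bound character_space \<sigma> M" and M: "M \<ge> 0"
  obtains F where "is_bse_extension \<sigma> F" "\<And>x. x \<in> bse_predual \<Longrightarrow> cmod (F x) \<le> M * norm x"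
proof -
  obtain G where "continuous_on bse_predual G"
    and G: "\<And>x y. x \<in> bse_predual \<Longrightarrow> y \<in> bse_predual \<Longrightarrow> G (x + y) = G x + G y"
    "\<And>c x. x \<in> bse_predual \<Longrightarrow> G (c *\<^sub>C x) = c *\<^sub>C G x"
    "\<And>x. x \<in> bse_predual \<Longrightarrow> norm (G x) \<le> M * norm x"
    "\<And>(n::nat) \<phi> c. \<forall>j<n. \<phi> j \<in> character_space \<Longrightarrow>
      G (\<Sum>j<n. c j *\<^sub>C \<phi> j) = (\<Sum>j<n. c j *\<^sub>C \<sigma> (\<phi> j))"
    by (rule closed_cspan_extension[OF assms, folded bse_predual_def]) (rule that)
  \<comment> \<open>The cut-off outside the predual is the representation that
    \<open>dual_on\<close> prescribes.\<close>
  have ext: "is_bse_extension \<sigma> (\<lambda>x. if x \<in> bse_predual then G x else 0)"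
    unfolding is_bse_extension_iff
  proof (intro conjI ballI)
    show "(\<lambda>x. if x \<in> bse_predual then G x else 0) \<in> dual_on bse_predual"
      using csubspace_bse_predual G(1-3)
      by (intro dual_onI[where K = M]) (auto simp: complex_vector.subspace_def)
    fix \<phi> :: "'a \<Rightarrow>\<^sub>L complex" assume "\<phi> \<in> character_space"
    then show "(if \<phi> \<in> bse_predual then G \<phi> else 0) = \<sigma> \<phi>"
      using G(4)[of 1 "\<lambda>_. \<phi>" "\<lambda>_. 1"] character_space_subset_bse_predual
      by (auto simp: scaleC_one)
  qed
  show ?thesis
    by (rule that[OF ext]) (simp add: G(3))
qed

lemma csubspace_dual_space: "csubspace dual_space"
  by (auto simp: complex_vector.subspace_def dual_space_def blinfun.add_left
      scaleC_blinfun.rep_eq distrib_left mult.left_commute)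

lemma character_space_subset_dual_space: "character_space \<subseteq> dual_space"
  by (auto simp: character_space_def)

text \<open>Under the hypothesis on the topologies the inequality alone forces continuity;
  boundedness follows from it because characters have norm at most 1.\<close>

lemma mem_C_BSE_iff:
  fixes \<sigma> :: "('a::complex_normed_algebra \<Rightarrow>\<^sub>L complex) \<Rightarrow> complex"
  assumes top: "subtopology weak_topology (character_space :: ('a \<Rightarrow>\<^sub>L complex) set) =
      subtopology weak_star_topology character_space"
  shows "\<sigma> \<in> C_BSE \<longleftrightarrow> (\<forall>\<phi>. \<phi> \<notin> character_space \<longrightarrow> \<sigma> \<phi> = 0) \<and> (\<exists>M. bse_bound \<sigma> M)"
proof safe
  fix M assume zero: "\<forall>\<phi>. \<phi> \<notin> character_space \<longrightarrow> \<sigma> \<phi> = 0" and bse: "bse_bound \<sigma> M"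
  then have M: "comb_bound character_space \<sigma> M" "M \<ge> 0" by (simp_all add: bse_bound_iff)
  obtain F where F: "is_bse_extension \<sigma> F"
    using is_bse_extension_exists[OF M] by blast
  obtain G where G: "G \<in> dual_on UNIV" "\<And>x. x \<in> bse_predual \<Longrightarrow> G x = F x"
    using dual_on_extend[OF csubspace_bse_predual, of F] F by (auto simp: is_bse_extension_iff)
  \<comment> \<open>Elements of the blinfun type are only real-linear, and the Hahn-Banach extension
    lives on all of them. The weak topology is generated by functionals on
    \<open>dual_space\<close>, hence the restriction.\<close>
  define H where "H x = (if x \<in> dual_space then G x else 0)" for x
  have "H \<in> dual_on dual_space"
    using G(1) csubspace_dual_space by (auto simp: H_def dual_on_def complex_vector.subspace_def)
  then have "continuous_map weak_topology euclidean H"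
    unfolding weak_topology_def by (rule continuous_map_initial_topology_on)
  then have "continuous_map (subtopology weak_star_topology character_space) euclidean H"
    unfolding top[symmetric] by (rule continuous_map_from_subtopology)
  moreover have "H \<phi> = \<sigma> \<phi>" if "\<phi> \<in> character_space" for \<phi>
    using that F G(2) character_space_subset_dual_space character_space_subset_bse_predual
    by (auto simp: H_def is_bse_extension_iff)
  ultimately have "continuous_map (subtopology weak_star_topology character_space) euclidean \<sigma>"
    by (auto elim: continuous_map_eq)
  moreover have "bounded (\<sigma> ` character_space)"
  proof (rule boundedI)
    fix y assume "y \<in> \<sigma> ` character_space"
    then obtain \<phi> where \<phi>: "\<phi> \<in> character_space" "y = \<sigma> \<phi>" by blast
    with comb_bound_single[OF M(1)] mult_left_mono[OF norm_character_le_one M(2), of \<phi>]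
    show "norm y \<le> M" by fastforce
  qed
  ultimately show "\<sigma> \<in> C_BSE" using zero bse by (auto simp: C_BSE_def)
qed (auto simp: C_BSE_def)

text \<open>The operator \<open>G\<close> depends on \<open>\<tau>\<close> only: evaluating
  \<open>\<tau> * \<sigma>\<close> at \<open>p\<close> is evaluating \<open>\<sigma>\<close> at the
  fixed point \<open>G p\<close>, whatever \<open>\<sigma>\<close> is. Weak-* continuity rests on
  this uniformity.\<close>

lemma bse_predual_multiplier:
  fixes \<tau> :: "('a::complex_normed_algebra \<Rightarrow>\<^sub>L complex) \<Rightarrow> complex"
  assumes \<tau>: "comb_bound character_space \<tau> M" and M: "M \<ge> 0"
  obtains G where "G ` bse_predual \<subseteq> bse_predual"
    "\<And>\<sigma> F p. is_bse_extension \<sigma> F \<Longrightarrow> p \<in> bse_predual \<Longrightarrow> bse_extension (\<tau> * \<sigma>) p = F (G p)"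
proof -
  obtain G where cont: "continuous_on bse_predual G"
    and add: "\<And>x y. x \<in> bse_predual \<Longrightarrow> y \<in> bse_predual \<Longrightarrow> G (x + y) = G x + G y"
    and scale: "\<And>c x. x \<in> bse_predual \<Longrightarrow> G (c *\<^sub>C x) = c *\<^sub>C G x"
    and bound: "\<And>x. x \<in> bse_predual \<Longrightarrow> norm (G x) \<le> M * norm x"
    and sum: "\<And>(n::nat) \<phi> c. \<forall>j<n. \<phi> j \<in> character_space \<Longrightarrow>
      G (\<Sum>j<n. c j *\<^sub>C \<phi> j) = (\<Sum>j<n. c j *\<^sub>C \<tau> (\<phi> j) *\<^sub>C \<phi> j)"
    by (rule closed_cspan_extension[OF comb_bound_multiplier[OF assms] M, folded bse_predual_def])
      (rule that)
  have "G x \<in> bse_predual" if "x \<in> cspan character_space" for x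
    using that
  proof (rule cspan_sum)
    fix n :: nat and \<phi> c
    assume \<phi>: "\<And>j. j < n \<Longrightarrow> \<phi> j \<in> (character_space :: ('a \<Rightarrow>\<^sub>L complex) set)"
      and x: "x = (\<Sum>j<n. c j *\<^sub>C \<phi> j)"
    have "(\<Sum>j<n. c j *\<^sub>C \<tau> (\<phi> j) *\<^sub>C \<phi> j) \<in> bse_predual"
      using \<phi> character_space_subset_bse_predual
      by (intro complex_vector.subspace_sum complex_vector.subspace_scale csubspace_bse_predual) auto
    then show ?thesis using sum[of n \<phi> c] \<phi> x by simp
  qed
  \<comment> \<open>\<open>G\<close> maps the span into the closed predual, and by continuity the
    closure of the span as well.\<close>
  then have GB: "G ` bse_predual \<subseteq> bse_predual"
    using image_closure_subset[of "cspan character_space" G bse_predual] cont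
    by (auto simp: bse_predual_def)
  show ?thesis
  proof (rule that[OF GB])
    fix \<sigma> F :: "('a \<Rightarrow>\<^sub>L complex) \<Rightarrow> complex" and p :: "'a \<Rightarrow>\<^sub>L complex"
    assume F: "is_bse_extension \<sigma> F" and p: "p \<in> bse_predual"
    have dual: "F \<in> dual_on bse_predual" using F by (simp add: is_bse_extension_iff)
    obtain K where K: "K \<ge> 0" "\<And>x. x \<in> bse_predual \<Longrightarrow> cmod (F x) \<le> K * norm x"
      using dual_on_bounded[OF dual] by blast
    define H where "H x = (if x \<in> bse_predual then F (G x) else 0)" for x
    have "is_bse_extension (\<tau> * \<sigma>) H"
      unfolding is_bse_extension_iff
    proof (intro conjI ballI)
      have GBD: "G x \<in> bse_predual" if "x \<in> bse_predual" for x using GB that by blast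
      have "cmod (F (G x)) \<le> K * M * norm x" if "x \<in> bse_predual" for x
        using K(2)[OF GBD[OF that]] mult_left_mono[OF bound[OF that] K(1)]
        by (simp add: mult.assoc)
      then show "H \<in> dual_on bse_predual"
        using csubspace_bse_predual
        by (intro dual_onI[where K = "K * M"])
          (auto simp: H_def complex_vector.subspace_def add scale dual_onD[OF dual] GBD)
      fix \<phi> :: "'a \<Rightarrow>\<^sub>L complex" assume \<phi>: "\<phi> \<in> character_space"
      then have mem: "\<phi> \<in> bse_predual" using character_space_subset_bse_predual by blast
      have "G \<phi> = \<tau> \<phi> *\<^sub>C \<phi>"
        using sum[of 1 "\<lambda>_. \<phi>" "\<lambda>_. 1"] \<phi> by (simp add: scaleC_one)
      then show "H \<phi> = (\<tau> * \<sigma>) \<phi>"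
        using F \<phi> mem by (simp add: H_def dual_onD(3)[OF dual] is_bse_extension_iff)
    qed
    then show "bse_extension (\<tau> * \<sigma>) p = F (G p)"
      using p by (simp add: bse_extension_eqI H_def)
  qed
qed

section \<open>The dual Banach algebra of BSE-functions\<close>

theorem proposition2p6:
  assumes "semisimple TYPE('a::{complex_normed_algebra, comm_ring, banach})"
    and "subtopology weak_topology (character_space :: ('a \<Rightarrow>\<^sub>L complex) set) =
      subtopology weak_star_topology character_space"
  shows "(\<forall>\<sigma> \<in> (C_BSE :: (('a \<Rightarrow>\<^sub>L complex) \<Rightarrow> complex) set). \<exists>!F. is_bse_extension \<sigma> F) \<and>
    dual_banach_algebra (C_BSE :: (('a \<Rightarrow>\<^sub>L complex) \<Rightarrow> complex) set) bse_norm
      bse_predual bse_extension"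
proof -
  let ?D = "C_BSE :: (('a \<Rightarrow>\<^sub>L complex) \<Rightarrow> complex) set"
  let ?\<Delta> = "character_space :: ('a \<Rightarrow>\<^sub>L complex) set"
  let ?B = "bse_predual :: ('a \<Rightarrow>\<^sub>L complex) set"
  let ?T = "bse_extension :: (('a \<Rightarrow>\<^sub>L complex) \<Rightarrow> complex) \<Rightarrow> _"
  note mem = mem_C_BSE_iff[OF assms(2)]
  have memI: "\<sigma> \<in> ?D" if "\<And>\<phi>. \<phi> \<notin> ?\<Delta> \<Longrightarrow> \<sigma> \<phi> = 0" "comb_bound ?\<Delta> \<sigma> M" for \<sigma> M
    using that comb_bound_imp_bse_bound by (auto simp: mem)
  have zero: "\<sigma> \<phi> = 0" if "\<sigma> \<in> ?D" "\<phi> \<notin> ?\<Delta>" for \<sigma> \<phi>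
    using that by (simp add: mem)
  have comb: "comb_bound ?\<Delta> \<sigma> (bse_norm \<sigma>)" and nonneg: "0 \<le> bse_norm \<sigma>" if "\<sigma> \<in> ?D" for \<sigma>
    using that comb_bound_bse_norm bse_norm_nonneg by (auto simp: mem)
  \<comment> \<open>The BSE norm dominates the supremum norm; this yields definiteness and the
    pointwise limits needed for completeness.\<close>
  have apply_le: "cmod (\<sigma> \<phi>) \<le> bse_norm \<sigma>" if \<sigma>: "\<sigma> \<in> ?D" for \<sigma> \<phi>
  proof (cases "\<phi> \<in> ?\<Delta>")
    case True
    then show ?thesis
      using comb_bound_single[OF comb[OF \<sigma>] True]
        mult_left_mono[OF norm_character_le_one nonneg[OF \<sigma>], of \<phi>] by simp
  qed (simp add: zero nonneg \<sigma>)
  have comb_add: "comb_bound ?\<Delta> (\<sigma> + \<tau>) (bse_norm \<sigma> + bse_norm \<tau>)" if "\<sigma> \<in> ?D" "\<tau> \<in> ?D" for \<sigma> \<tau>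
    unfolding plus_fun_def using that by (intro comb_bound_add comb)
  have comb_scale: "comb_bound ?\<Delta> (c *\<^sub>C \<sigma>) (cmod c * bse_norm \<sigma>)" if "\<sigma> \<in> ?D" for c \<sigma>
    unfolding scaleC_fun_def using that by (intro comb_bound_scale comb)
  have comb_mult: "comb_bound ?\<Delta> (\<sigma> * \<tau>) (bse_norm \<sigma> * bse_norm \<tau>)" if "\<sigma> \<in> ?D" "\<tau> \<in> ?D" for \<sigma> \<tau>
    unfolding times_fun_def using that by (intro comb_bound_mult comb nonneg)
  have comb_zero: "comb_bound ?\<Delta> 0 0"
    by (simp add: comb_bound_def)
  have add_mem: "\<sigma> + \<tau> \<in> ?D" if "\<sigma> \<in> ?D" "\<tau> \<in> ?D" for \<sigma> \<tau>
    using that by (intro memI[OF _ comb_add]) (auto simp: zero)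
  have scale_mem: "c *\<^sub>C \<sigma> \<in> ?D" if "\<sigma> \<in> ?D" for c \<sigma>
    using that by (intro memI[OF _ comb_scale]) (auto simp: zero scaleC_fun_def)
  have mult_mem: "\<sigma> * \<tau> \<in> ?D" if "\<sigma> \<in> ?D" "\<tau> \<in> ?D" for \<sigma> \<tau>
    using that by (intro memI[OF _ comb_mult]) (auto simp: zero)
  have zero_mem: "0 \<in> ?D"
    by (rule memI[OF _ comb_zero]) simp
  have subspace: "csubspace ?D"
    using zero_mem add_mem scale_mem by (auto simp: complex_vector.subspace_def)
  have scale_le: "bse_norm (c *\<^sub>C \<sigma>) \<le> cmod c * bse_norm \<sigma>" if "\<sigma> \<in> ?D" for c \<sigma>
    using that by (intro bse_norm_le comb_scale mult_nonneg_nonneg nonneg) auto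
  have ext: "is_bse_extension \<sigma> (?T \<sigma>)" and ext_le: "p \<in> ?B \<Longrightarrow> cmod (?T \<sigma> p) \<le> bse_norm \<sigma> * norm p"
    if \<sigma>: "\<sigma> \<in> ?D" for \<sigma> p
  proof -
    obtain F where "is_bse_extension \<sigma> F" "\<And>x. x \<in> ?B \<Longrightarrow> cmod (F x) \<le> bse_norm \<sigma> * norm x"
      using is_bse_extension_exists[OF comb[OF \<sigma>] nonneg[OF \<sigma>]] by blast
    then show "is_bse_extension \<sigma> (?T \<sigma>)" "p \<in> ?B \<Longrightarrow> cmod (?T \<sigma> p) \<le> bse_norm \<sigma> * norm p"
      by (simp_all add: bse_extension_eqI)
  qed
  have T_dual: "?T \<sigma> \<in> dual_on ?B" and T_apply: "\<phi> \<in> ?\<Delta> \<Longrightarrow> ?T \<sigma> \<phi> = \<sigma> \<phi>"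
    if "\<sigma> \<in> ?D" for \<sigma> \<phi>
    using ext[OF that] by (auto simp: is_bse_extension_iff)
  \<comment> \<open>A functional restricts to a BSE-function with its dual norm as constant. This
    serves both surjectivity of the identification and the lower estimate of the isometry.\<close>
  have restrict_comb: "comb_bound ?\<Delta> (\<lambda>\<phi>. if \<phi> \<in> ?\<Delta> then F \<phi> else 0) (dual_norm_on ?B F)"
    if F: "F \<in> dual_on ?B" for F
  proof (rule comb_boundI)
    fix n :: nat and \<phi> c assume \<phi>: "\<And>j. j < n \<Longrightarrow> \<phi> j \<in> ?\<Delta>"
    have B: "\<phi> j \<in> ?B" if "j < n" for j
      using \<phi>[OF that] character_space_subset_bse_predual by blast
    have "(\<Sum>j<n. c j *\<^sub>C \<phi> j) \<in> ?B"
      using B by (intro complex_vector.subspace_sum complex_vector.subspace_scale csubspace_bse_predual) auto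
    from dual_norm_on_bound[OF csubspace_bse_predual F this]
    show "norm (\<Sum>j<n. c j *\<^sub>C (if \<phi> j \<in> ?\<Delta> then F (\<phi> j) else 0)) \<le>
        dual_norm_on ?B F * norm (\<Sum>j<n. c j *\<^sub>C \<phi> j)"
      using \<phi> by (simp add: dual_on_sum[OF csubspace_bse_predual F B])
  qed
  have T_mult: "continuous_map (predual_topology ?D ?B ?T) (predual_topology ?D ?B ?T) (\<lambda>x. \<tau> * x)"
    if \<tau>: "\<tau> \<in> ?D" for \<tau>
  proof -
    obtain G where GB: "G ` ?B \<subseteq> ?B"
      and G: "\<And>\<sigma> F p. is_bse_extension \<sigma> F \<Longrightarrow> p \<in> ?B \<Longrightarrow> ?T (\<tau> * \<sigma>) p = F (G p)"
      using bse_predual_multiplier[OF comb[OF \<tau>] nonneg[OF \<tau>]] by blast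
    have ne: "(\<lambda>p x. ?T x p) ` ?B \<noteq> {}"
      using complex_vector.subspace_0[OF csubspace_bse_predual] by blast
    note topspace = topspace_initial_topology_on[OF ne, of ?D]
    show ?thesis
      unfolding predual_topology_def
    proof (rule continuous_map_into_initial_topology_on[OF ne])
      show "(*) \<tau> \<in> topspace (initial_topology_on ?D ((\<lambda>p x. ?T x p) ` ?B)) \<rightarrow> ?D"
        using mult_mem[OF \<tau>] by (simp add: topspace)
      fix f assume "f \<in> (\<lambda>p x. ?T x p) ` ?B"
      then obtain p where p: "p \<in> ?B" "f = (\<lambda>x. ?T x p)" by blast
      \<comment> \<open>Since \<open>G p\<close> lies in the predual, evaluation there is again one
        of the generating functions.\<close>
      have "continuous_map (initial_topology_on ?D ((\<lambda>p x. ?T x p) ` ?B)) euclidean (\<lambda>x. ?T x (G p))"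
        using GB p by (intro continuous_map_initial_topology_on) blast
      then show "continuous_map (initial_topology_on ?D ((\<lambda>p x. ?T x p) ` ?B)) euclidean
          (\<lambda>x. f (\<tau> * x))"
        by (rule continuous_map_eq) (simp add: topspace p G[OF ext])
    qed
  qed
  have "\<exists>!F. is_bse_extension \<sigma> F" if "\<sigma> \<in> ?D" for \<sigma>
    using ext[OF that] is_bse_extension_unique by blast
  moreover have "dual_banach_algebra ?D bse_norm ?B ?T"
  proof
    fix \<sigma> \<tau> :: "('a \<Rightarrow>\<^sub>L complex) \<Rightarrow> complex" and c
    assume \<sigma>: "\<sigma> \<in> ?D"
    show "0 \<le> bse_norm \<sigma>" by (rule nonneg[OF \<sigma>])
    show "bse_norm \<sigma> = 0 \<longleftrightarrow> \<sigma> = 0"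
    proof
      assume "bse_norm \<sigma> = 0"
      then have "\<sigma> \<phi> = 0" for \<phi> using apply_le[OF \<sigma>, of \<phi>] by simp
      then show "\<sigma> = 0" by (simp add: fun_eq_iff)
    next
      assume "\<sigma> = 0"
      then show "bse_norm \<sigma> = 0" using bse_norm_le[OF comb_zero] nonneg[OF zero_mem] by simp
    qed
    show "bse_norm (c *\<^sub>C \<sigma>) = cmod c * bse_norm \<sigma>"
    proof (cases "c = 0")
      case True
      then show ?thesis using scale_le[OF \<sigma>, of 0] nonneg[OF scale_mem[OF \<sigma>, of 0]] by simp
    next
      case False
      \<comment> \<open>The reverse inequality is \<open>scale_le\<close> applied to
        \<open>c *\<^sub>C \<sigma>\<close> and \<open>inverse c\<close>.\<close>
      then have "bse_norm \<sigma> \<le> cmod (inverse c) * bse_norm (c *\<^sub>C \<sigma>)"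
        using scale_le[OF scale_mem[OF \<sigma>, of c], of "inverse c"] by (simp add: scaleC_scaleC scaleC_one)
      then show ?thesis
        using scale_le[OF \<sigma>, of c] False by (simp add: norm_inverse norm_divide field_simps)
    qed
    show "?T (c *\<^sub>C \<sigma>) = c *\<^sub>C ?T \<sigma>"
    proof (rule bse_extension_eqI, unfold is_bse_extension_iff, intro conjI ballI)
      obtain K where "\<And>x. x \<in> ?B \<Longrightarrow> cmod (?T \<sigma> x) \<le> K * norm x"
        using dual_on_bounded[OF T_dual[OF \<sigma>]] by blast
      then have "cmod (c * ?T \<sigma> x) \<le> (cmod c * K) * norm x" if "x \<in> ?B" for x
        using that by (simp add: norm_mult mult_left_mono mult.assoc)
      then show "c *\<^sub>C ?T \<sigma> \<in> dual_on ?B"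
        using dual_onD[OF T_dual[OF \<sigma>]]
        by (auto simp: dual_on_def scaleC_fun_def distrib_left)
    qed (simp add: scaleC_fun_def T_apply[OF \<sigma>])
    show "dual_norm_on ?B (?T \<sigma>) = bse_norm \<sigma>"
    proof (rule antisym)
      show "dual_norm_on ?B (?T \<sigma>) \<le> bse_norm \<sigma>"
        by (intro dual_norm_on_le csubspace_bse_predual nonneg ext_le \<sigma>)
      have "0 \<le> dual_norm_on ?B (?T \<sigma>)"
        by (rule dual_norm_on_nonneg[OF csubspace_bse_predual T_dual[OF \<sigma>]])
      moreover have "(\<lambda>\<phi>. if \<phi> \<in> ?\<Delta> then ?T \<sigma> \<phi> else 0) = \<sigma>"
        using T_apply[OF \<sigma>] zero[OF \<sigma>] by auto
      ultimately show "bse_norm \<sigma> \<le> dual_norm_on ?B (?T \<sigma>)"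
        using bse_norm_le[OF restrict_comb[OF T_dual[OF \<sigma>]]] by simp
    qed
    show "continuous_map (predual_topology ?D ?B ?T) (predual_topology ?D ?B ?T) (\<lambda>x. \<sigma> * x)"
      by (rule T_mult[OF \<sigma>])
    then show "continuous_map (predual_topology ?D ?B ?T) (predual_topology ?D ?B ?T) (\<lambda>x. x * \<sigma>)"
      by (simp add: mult.commute)
    assume \<tau>: "\<tau> \<in> ?D"
    show "\<sigma> * \<tau> \<in> ?D" by (rule mult_mem[OF \<sigma> \<tau>])
    show "bse_norm (\<sigma> + \<tau>) \<le> bse_norm \<sigma> + bse_norm \<tau>"
      using \<sigma> \<tau> by (intro bse_norm_le comb_add add_nonneg_nonneg nonneg)
    show "bse_norm (\<sigma> * \<tau>) \<le> bse_norm \<sigma> * bse_norm \<tau>"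
      using \<sigma> \<tau> by (intro bse_norm_le comb_mult mult_nonneg_nonneg nonneg)
    show "?T (\<sigma> + \<tau>) = ?T \<sigma> + ?T \<tau>"
    proof (rule bse_extension_eqI, unfold is_bse_extension_iff, intro conjI ballI)
      have "cmod (?T \<sigma> x + ?T \<tau> x) \<le> (bse_norm \<sigma> + bse_norm \<tau>) * norm x" if "x \<in> ?B" for x
        using norm_triangle_mono[OF ext_le[OF \<sigma> that] ext_le[OF \<tau> that]]
        by (simp add: distrib_right)
      then show "?T \<sigma> + ?T \<tau> \<in> dual_on ?B"
        using dual_onD[OF T_dual[OF \<sigma>]] dual_onD[OF T_dual[OF \<tau>]]
        by (auto simp: dual_on_def distrib_left)
    qed (simp add: T_apply \<sigma> \<tau>)
  next
    fix X :: "nat \<Rightarrow> ('a \<Rightarrow>\<^sub>L complex) \<Rightarrow> complex"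
    assume X: "\<And>n. X n \<in> ?D"
      and cauchy: "\<And>e. e > 0 \<Longrightarrow> \<exists>K. \<forall>m\<ge>K. \<forall>n\<ge>K. bse_norm (X m - X n) < e"
    have diff_mem: "X m - X n \<in> ?D" for m n
      by (rule complex_vector.subspace_diff[OF subspace X X])
    \<comment> \<open>The limit is built pointwise; outside the characters it is the limit of
      zeros.\<close>
    define x where "x \<phi> = lim (\<lambda>n. X n \<phi>)" for \<phi>
    have "Cauchy (\<lambda>n. X n \<phi>)" for \<phi>
    proof (rule CauchyI)
      fix e :: real assume "e > 0"
      with cauchy obtain K where K: "\<And>m n. m \<ge> K \<Longrightarrow> n \<ge> K \<Longrightarrow> bse_norm (X m - X n) < e" by meson
      then have "cmod (X m \<phi> - X n \<phi>) < e" if "m \<ge> K" "n \<ge> K" for m n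
        using apply_le[OF diff_mem[of m n], of \<phi>] K[OF that] by simp
      then show "\<exists>K. \<forall>m\<ge>K. \<forall>n\<ge>K. norm (X m \<phi> - X n \<phi>) < e" by blast
    qed
    then have lim: "(\<lambda>n. X n \<phi>) \<longlonglongrightarrow> x \<phi>" for \<phi>
      unfolding x_def by (simp add: Cauchy_convergent_iff convergent_LIMSEQ_iff)
    \<comment> \<open>With \<open>n\<close> fixed, \<open>m\<close> tends to infinity in the
      inequality for each single combination; its sum is finite, so pointwise convergence is enough,
      and \<open>K\<close> does not depend on the combination.\<close>
    have tail: "\<exists>K. \<forall>n\<ge>K. comb_bound ?\<Delta> (X n - x) e" if e: "e > 0" for e
    proof -
      obtain K where K: "\<And>m n. m \<ge> K \<Longrightarrow> n \<ge> K \<Longrightarrow> bse_norm (X m - X n) < e"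
        using cauchy[OF e] by meson
      have "comb_bound ?\<Delta> (X n - x) e" if n: "n \<ge> K" for n
      proof (rule comb_boundI)
        fix l :: nat and \<phi> c assume \<phi>: "\<And>j. j < l \<Longrightarrow> \<phi> j \<in> ?\<Delta>"
        have "cmod (\<Sum>j<l. c j *\<^sub>C (X n - X m) (\<phi> j)) \<le> e * norm (\<Sum>j<l. c j *\<^sub>C \<phi> j)"
          if "m \<ge> K" for m
          using K[OF n that] by (intro comb_boundD[OF comb_bound_mono[OF comb[OF diff_mem]]] \<phi>) auto
        moreover have "(\<lambda>m. cmod (\<Sum>j<l. c j *\<^sub>C (X n - X m) (\<phi> j))) \<longlonglongrightarrow>
            cmod (\<Sum>j<l. c j *\<^sub>C (X n - x) (\<phi> j))"
          by (auto intro!: tendsto_intros lim)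
        ultimately show "norm (\<Sum>j<l. c j *\<^sub>C (X n - x) (\<phi> j)) \<le> e * norm (\<Sum>j<l. c j *\<^sub>C \<phi> j)"
          by (intro LIMSEQ_le_const2) auto
      qed
      then show ?thesis by blast
    qed
    have x_zero: "x \<phi> = 0" if "\<phi> \<notin> ?\<Delta>" for \<phi>
      using lim[of \<phi>] zero[OF X that] by (auto intro: LIMSEQ_unique)
    \<comment> \<open>Membership of \<open>x\<close> comes from one difference:
      \<open>X K - x\<close> is a BSE-function with constant 1, and \<open>x\<close> is
      \<open>X K\<close> minus it.\<close>
    obtain K where "comb_bound ?\<Delta> (X K - x) 1"
      using tail[of 1] by auto
    then have "X K - x \<in> ?D"
      by (intro memI[where M = 1]) (auto simp: x_zero zero[OF X])
    then have "X K - (X K - x) \<in> ?D"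
      by (rule complex_vector.subspace_diff[OF subspace X])
    then have x: "x \<in> ?D" by simp
    have "(\<lambda>n. bse_norm (X n - x)) \<longlonglongrightarrow> 0"
    proof (rule LIMSEQ_I)
      fix e :: real assume e: "e > 0"
      \<comment> \<open>Half of \<open>e\<close>, because \<open>bse_norm_le\<close> gives a weak
        inequality and convergence asks for a strict one.\<close>
      then obtain K where K: "\<And>n. n \<ge> K \<Longrightarrow> comb_bound ?\<Delta> (X n - x) (e / 2)"
        using tail[of "e / 2"] by auto
      have "norm (bse_norm (X n - x) - 0) < e" if "n \<ge> K" for n
        using bse_norm_le[OF K[OF that]] nonneg[OF complex_vector.subspace_diff[OF subspace X x]] e
        by simp
      then show "\<exists>K. \<forall>n\<ge>K. norm (bse_norm (X n - x) - 0) < e" by blast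
    qed
    with x show "\<exists>x\<in>?D. (\<lambda>n. bse_norm (X n - x)) \<longlonglongrightarrow> 0" by blast
  next
    show "csubspace ?D" by (rule subspace)
    show "csubspace ?B" by (rule csubspace_bse_predual)
    show "complete ?B" by (simp add: bse_predual_def complete_eq_closed)
    show "bij_betw ?T ?D (dual_on ?B)"
      unfolding bij_betw_def
    proof
      show "inj_on ?T ?D"
      proof (rule inj_onI)
        fix \<sigma> \<tau> assume \<sigma>: "\<sigma> \<in> ?D" and \<tau>: "\<tau> \<in> ?D" and eq: "?T \<sigma> = ?T \<tau>"
        show "\<sigma> = \<tau>"
        proof
          fix \<phi>
          show "\<sigma> \<phi> = \<tau> \<phi>"
            using T_apply[OF \<sigma>, of \<phi>] T_apply[OF \<tau>, of \<phi>] zero[OF \<sigma>, of \<phi>] zero[OF \<tau>, of \<phi>] eq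
            by (cases "\<phi> \<in> ?\<Delta>") auto
        qed
      qed
      show "?T ` ?D = dual_on ?B"
      proof
        show "?T ` ?D \<subseteq> dual_on ?B" using T_dual by blast
        show "dual_on ?B \<subseteq> ?T ` ?D"
        proof
          fix F assume F: "F \<in> dual_on ?B"
          let ?\<sigma> = "\<lambda>\<phi>. if \<phi> \<in> ?\<Delta> then F \<phi> else 0"
          have "?\<sigma> \<in> ?D" by (rule memI[OF _ restrict_comb[OF F]]) simp
          moreover have "?T ?\<sigma> = F"
            using F by (intro bse_extension_eqI) (simp add: is_bse_extension_iff)
          ultimately show "F \<in> ?T ` ?D" by (metis (no_types, lifting) image_eqI)
        qed
      qed
    qed
  qed
  ultimately show ?thesis by blast
qed

end
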